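(* Let $(G,\mathbf d,\mathbf n,\mathbf s)$ be a generic direction-slider network. Then $(G,\mathbf d,\mathbf n,\mathbf s)$ has a unique faithful realization if and only if $G$ is a looped-Laman graph. (Here "generic" means: for every looped graph $G$ with $m$ edges and $c$ loops there is a proper algebraic subset of $\mathbb R^{2m+3c}$ such that the equivalence holds for all $(\mathbf d,\mathbf n,\mathbf s)\in\mathbb R^{2m+3c}$ outside this subset.)
   Context: Looped graph: a finite graph $G=(V,E)$ with $n$ vertices, $m$ edges between distinct vertices and $c$ self-loops (at most two parallel copies of each edge and at most two loops per vertex). "Edge" means a non-loop edge; $i_j$ denotes the $j$-th loop on vertex $i$. Looped-Laman graph: a looped graph with $m+c=2n$ such that (i) every subgraph with $n'\ge 2$ vertices has at most $2n'-3$ edges (loops not counted), and (ii) every subgraph with $n'$ vertices, $m'$ edges and $c'$ loops satisfies $m'+c'\le 2n'$. Direction-slider network $(G,\mathbf d,\mathbf n,\mathbf s)$: a looped graph $G$ with a direction $\mathbf d_{ij}\in\mathbb R^2$ for each edge $ij$ and, for each loop $i_j$, a slider, i.e. the line $\langle\mathbf n_{i_j},\mathbf x\rangle=s_{i_j}$ with $\mathbf n_{i_j}\in\mathbb R^2$, $s_{i_j}\in\mathbb R$. A realization $G(\mathbf p)$ is given by $\mathbf p=(\mathbf p_1,\dots,\mathbf p_n)\in(\mathbb R^2)^n$ satisfying $\langle \mathbf p_i-\mathbf p_j,\mathbf d_{ij}^{\perp}\rangle=0$ for all edges $ij$ and $\langle\mathbf p_i,\mathbf n_{i_j}\rangle=s_{i_j}$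 for all loops $i_j$, where $(a,b)^\perp$ is $(a,b)$ rotated by $90^\circ$. An edge $ij$ is collapsed if $\mathbf p_i=\mathbf p_j$; a realization is faithful if no edge is collapsed. *)

theory Defs
  imports "HOL-Analysis.Analysis"
begin

section \<open>Looped graphs\<close>

text \<open>
  Undirected multigraphs with self-loops. Edges joining distinct vertices and self-loops are
  kept in two separate sets, so that "edge" always means a non-loop edge; parallel edges are
  distinct elements with the same ends, and the loops on a vertex are distinct elements with the
  same base.
\<close>

record ('v, 'e, 'l) looped_graph =
  verts :: "'v set"
  edges :: "'e set"
  loops :: "'l set"
  ends :: "'e \<Rightarrow> 'v set"
  base :: "'l \<Rightarrow> 'v"

locale looped_graph =
  fixes G :: "('v, 'e, 'l) looped_graph"
  assumes finite_verts: "finite (verts G)"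
    and finite_edges: "finite (edges G)"
    and finite_loops: "finite (loops G)"
    and ends_subset: "e \<in> edges G \<Longrightarrow> ends G e \<subseteq> verts G"
    and card_ends: "e \<in> edges G \<Longrightarrow> card (ends G e) = 2"
    and base_in_verts: "l \<in> loops G \<Longrightarrow> base G l \<in> verts G"
    and at_most_two_parallel: "card {e \<in> edges G. ends G e = {i, j}} \<le> 2"
    and at_most_two_loops: "card {l \<in> loops G. base G l = i} \<le> 2"

definition subgraph :: "('v, 'e, 'l) looped_graph \<Rightarrow> ('v, 'e, 'l) looped_graph \<Rightarrow> bool"
  where "subgraph H G \<longleftrightarrow>
    looped_graph H \<and>
    verts H \<subseteq> verts G \<and> edges H \<subseteq> edges G \<and> loops H \<subseteq> loops G \<and>
    (\<forall>e \<in> edges H. ends H e = ends G e) \<and>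
    (\<forall>l \<in> loops H. base H l = base G l)"

text \<open>The natural-number subtraction below does not truncate, since \<open>2 \<le> card (verts H)\<close>.\<close>

definition looped_Laman :: "('v, 'e, 'l) looped_graph \<Rightarrow> bool"
  where "looped_Laman G \<longleftrightarrow>
    card (edges G) + card (loops G) = 2 * card (verts G) \<and>
    (\<forall>H. subgraph H G \<and> 2 \<le> card (verts H) \<longrightarrow>
      card (edges H) \<le> 2 * card (verts H) - 3) \<and>
    (\<forall>H. subgraph H G \<longrightarrow>
      card (edges H) + card (loops H) \<le> 2 * card (verts H))"


section \<open>Direction-slider networks\<close>

text \<open>
  A network on \<open>G\<close> is given by edge directions \<open>d\<close>, slider normals \<open>\<nu>\<close> and slider offsets \<open>s\<close>;
  only their values on \<open>edges G\<close> and \<open>loops G\<close> matter.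
\<close>

definition perp :: "real ^ 2 \<Rightarrow> real ^ 2"
  where "perp v = vector [- (v $ 2), v $ 1]"

text \<open>
  Points are extensional functions on the vertex set, i.e. elements of \<open>(\<real>\<^sup>2)\<^sup>n\<close>, so that uniqueness
  is meaningful. The edge equation does not depend on the order in which the ends are taken.
\<close>

definition realization ::
  "('v, 'e, 'l) looped_graph \<Rightarrow> ('e \<Rightarrow> real ^ 2) \<Rightarrow> ('l \<Rightarrow> real ^ 2) \<Rightarrow> ('l \<Rightarrow> real) \<Rightarrow>
    ('v \<Rightarrow> real ^ 2) \<Rightarrow> bool"
  where "realization G d \<nu> s p \<longleftrightarrow>
    p \<in> verts G \<rightarrow>\<^sub>E UNIV \<and>
    (\<forall>e \<in> edges G. \<forall>i j. ends G e = {i, j} \<longrightarrow> (p i - p j) \<bullet> perp (d e) = 0) \<and>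
    (\<forall>l \<in> loops G. p (base G l) \<bullet> \<nu> l = s l)"

definition collapsed :: "('v, 'e, 'l) looped_graph \<Rightarrow> ('v \<Rightarrow> real ^ 2) \<Rightarrow> 'e \<Rightarrow> bool"
  where "collapsed G p e \<longleftrightarrow> (\<exists>i j. ends G e = {i, j} \<and> p i = p j)"

definition faithful :: "('v, 'e, 'l) looped_graph \<Rightarrow> ('v \<Rightarrow> real ^ 2) \<Rightarrow> bool"
  where "faithful G p \<longleftrightarrow> (\<forall>e \<in> edges G. \<not> collapsed G p e)"


section \<open>Algebraic subsets of the parameter space\<close>

text \<open>
  \<open>\<real>\<^sup>K\<close> for a finite index set \<open>K\<close> is \<open>K \<rightarrow>\<^sub>E UNIV\<close>. The polynomial functions follow the pattern of
  \<^const>\<open>real_polynomial_function\<close>, which is not applicable as \<open>K\<close> is a set (possibly empty) and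
  not a type.
\<close>

inductive polynomial_on :: "'k set \<Rightarrow> (('k \<Rightarrow> real) \<Rightarrow> real) \<Rightarrow> bool" for K
  where
    coordinate: "k \<in> K \<Longrightarrow> polynomial_on K (\<lambda>x. x k)"
  | const: "polynomial_on K (\<lambda>x. c)"
  | add: "polynomial_on K f \<Longrightarrow> polynomial_on K g \<Longrightarrow> polynomial_on K (\<lambda>x. f x + g x)"
  | mult: "polynomial_on K f \<Longrightarrow> polynomial_on K g \<Longrightarrow> polynomial_on K (\<lambda>x. f x * g x)"

definition algebraic_subset :: "'k set \<Rightarrow> ('k \<Rightarrow> real) set \<Rightarrow> bool"
  where "algebraic_subset K A \<longleftrightarrow>
    (\<exists>F. finite F \<and> (\<forall>f \<in> F. polynomial_on K f) \<and>
      A = {x \<in> K \<rightarrow>\<^sub>E UNIV. \<forall>f \<in> F. f x = 0})"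

definition proper_algebraic_subset :: "'k set \<Rightarrow> ('k \<Rightarrow> real) set \<Rightarrow> bool"
  where "proper_algebraic_subset K A \<longleftrightarrow> algebraic_subset K A \<and> A \<noteq> K \<rightarrow>\<^sub>E UNIV"

datatype ('e, 'l) coord =
    Dir1 'e | Dir2 'e
  | Normal1 'l | Normal2 'l | Offset 'l

definition coords :: "('v, 'e, 'l) looped_graph \<Rightarrow> ('e, 'l) coord set"
  where "coords G =
    Dir1 ` edges G \<union> Dir2 ` edges G \<union>
    Normal1 ` loops G \<union> Normal2 ` loops G \<union> Offset ` loops G"

lemma (in looped_graph) card_coords:
  "card (coords G) = 2 * card (edges G) + 3 * card (loops G)"
proof -
  have "card (coords G) = card (Dir1 ` edges G :: ('e, 'l) coord set)
      + card (Dir2 ` edges G :: ('e, 'l) coord set)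
      + card (Normal1 ` loops G :: ('e, 'l) coord set)
      + card (Normal2 ` loops G :: ('e, 'l) coord set)
      + card (Offset ` loops G :: ('e, 'l) coord set)"
    unfolding coords_def using finite_edges finite_loops
    by (subst card_Un_disjoint; auto)+
  then show ?thesis
    by (simp add: card_image inj_on_def)
qed

text \<open>The network \<open>(d, \<nu>, s)\<close> on \<open>G\<close> as a point of \<open>\<real>\<^sup>K\<close> with \<open>K = coords G\<close>.\<close>

definition network_point ::
  "('v, 'e, 'l) looped_graph \<Rightarrow> ('e \<Rightarrow> real ^ 2) \<Rightarrow> ('l \<Rightarrow> real ^ 2) \<Rightarrow> ('l \<Rightarrow> real) \<Rightarrow>
    ('e, 'l) coord \<Rightarrow> real"
  where "network_point G d \<nu> s = (\<lambda>k \<in> coords G.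
    case k of
      Dir1 e \<Rightarrow> d e $ 1
    | Dir2 e \<Rightarrow> d e $ 2
    | Normal1 l \<Rightarrow> \<nu> l $ 1
    | Normal2 l \<Rightarrow> \<nu> l $ 2
    | Offset l \<Rightarrow> s l)"

end

theory Submission
  imports Defs "HOL-Library.Function_Algebras" "HOL-Computational_Algebra.Polynomial"
begin

text \<open>
  A network is a linear system in the coordinates of the points; join each loop to an extra ground
  vertex, fixed at the origin. If all directions and normals are parallel to the axes, the system
  splits into the incidence systems of two graphs, so it is nonsingular as soon as these are
  connected. By Rado's theorem such a splitting of a graph on \<open>n + 1\<close> vertices with \<open>2 n\<close> edges exists
  if no \<open>n'\<close> vertices span more than \<open>2 n' - 2\<close> edges. Eliminating unknowns turns nonsingularity at
  one point into nonvanishing of a polynomial.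

  If the edges violate \<open>m' \<le> 2 n' - 3\<close>, a minimal violation has a generically maximal rank, whence it
  collapses. If only the total count is violated, then a minimal violation is a nonsingular system
  together with one further slider, and the generic offset of the latter excludes realizations. The
  same argument for a looped-Laman graph with one edge doubled shows that this edge does not
  collapse.
\<close>

section \<open>Polynomial functions and generic properties\<close>

text \<open>The ground turns sliders into edges, and \<open>2 n\<close> is the number of edges of
  two disjoint spanning trees on \<open>n + 1\<close> vertices; hence the bounds \<open>2 n'\<close>
  for \<open>n'\<close> vertices together with the ground and \<open>2 n' - 2\<close> without it.
  The Laman bound is stricter by one, and this slack lets an edge be doubled without losing the
  count needed for the splitting. An axis-parallel witness shows nonsingularity only and controls no
  collapse, so faithfulness has to be recast as unsolvability of a larger system. Unsolvability
  needs a row whose right-hand side is free. Direction constraints are homogeneous, so this row must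
  be a slider; that is why the deleted row touches the ground and why the edge counts are settled
  before the total count. Additional constraints (sliders pinning a vertex, the copy of an edge)
  have no coordinates in the parameter space: their normals are constants chosen along with the
  witness, so the resulting polynomial involves the network alone.\<close>

lemma polynomial_on_uminus: "polynomial_on K f \<Longrightarrow> polynomial_on K (\<lambda>x. - f x)"
  using polynomial_on.mult[OF polynomial_on.const[of K "-1"], of f] by simp

lemma polynomial_on_diff:
  "polynomial_on K f \<Longrightarrow> polynomial_on K g \<Longrightarrow> polynomial_on K (\<lambda>x. f x - g x)"
  using polynomial_on.add[OF _ polynomial_on_uminus, of K f g] by simp

lemma polynomial_on_restrict: "polynomial_on K f \<Longrightarrow> f (restrict x K) = f x"
  by (induction rule: polynomial_on.induct) auto

lemma polynomial_on_line:
  assumes "polynomial_on K f"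
  shows "\<exists>p :: real poly. \<forall>t. f (\<lambda>k. x k + t * y k) = poly p t"
  using assms
proof induction
  case (coordinate k)
  have "\<forall>t. x k + t * y k = poly [:x k, y k:] t"
    by simp
  then show ?case by blast
next
  case (const c)
  have "\<forall>t. c = poly [:c:] t"
    by simp
  then show ?case by blast
next
  case (add f g)
  then show ?case by (metis poly_add)
next
  case (mult f g)
  then show ?case by (metis poly_mult)
qed

text \<open>On the line through \<open>x\<close> (at \<open>t = 0\<close>) and \<open>y\<close> (at
  \<open>t = 1\<close>) both functions become nonzero univariate polynomials, and their product has
  a nonroot.\<close>

lemma polynomial_on_mult_nonzero:
  assumes f: "polynomial_on K f" "f x \<noteq> 0" and g: "polynomial_on K g" "g y \<noteq> 0"
  shows "\<exists>z. f z * g z \<noteq> 0"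
proof -
  let ?z = "\<lambda>t k. x k + t * (y k - x k)"
  obtain p where p: "\<And>t. f (?z t) = poly p t"
    using polynomial_on_line[OF f(1), of x "\<lambda>k. y k - x k"] by blast
  obtain q where q: "\<And>t. g (?z t) = poly q t"
    using polynomial_on_line[OF g(1), of x "\<lambda>k. y k - x k"] by blast
  have "poly p 0 \<noteq> 0" "poly q 1 \<noteq> 0"
    using f(2) g(2) by (simp_all flip: p q)
  then have "p * q \<noteq> 0"
    by auto
  then obtain t where "poly (p * q) t \<noteq> 0"
    using poly_all_0_iff_0 by blast
  then show ?thesis
    by (auto simp: p q intro!: exI[of _ "?z t"])
qed

text \<open>One polynomial stands for the complement of an algebraic subset, so that conjunctions
  become products. The points are arbitrary functions instead of extensional ones, which keeps lines
  and witnesses free of side conditions outside \<open>K\<close>; restricting a point to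
  \<open>K\<close> changes no value of \<open>f\<close>.\<close>

definition generically :: "'k set \<Rightarrow> (('k \<Rightarrow> real) \<Rightarrow> bool) \<Rightarrow> bool"
  where "generically K \<Phi> \<longleftrightarrow>
    (\<exists>f. polynomial_on K f \<and> (\<exists>x. f x \<noteq> 0) \<and> (\<forall>x. f x \<noteq> 0 \<longrightarrow> \<Phi> x))"

lemma generically_mono: "generically K \<Phi> \<Longrightarrow> (\<And>x. \<Phi> x \<Longrightarrow> \<Psi> x) \<Longrightarrow> generically K \<Psi>"
  unfolding generically_def by blast

lemma generically_True: "generically K (\<lambda>x. True)"
  unfolding generically_def using polynomial_on.const[of K 1] by force

lemma generically_conj:
  assumes "generically K \<Phi>" "generically K \<Psi>"
  shows "generically K (\<lambda>x. \<Phi> x \<and> \<Psi> x)"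
proof -
  obtain f x where f: "polynomial_on K f" "f x \<noteq> 0" "\<And>x. f x \<noteq> 0 \<Longrightarrow> \<Phi> x"
    using assms(1) unfolding generically_def by blast
  obtain g y where g: "polynomial_on K g" "g y \<noteq> 0" "\<And>x. g x \<noteq> 0 \<Longrightarrow> \<Psi> x"
    using assms(2) unfolding generically_def by blast
  show ?thesis
    unfolding generically_def
    using polynomial_on.mult[OF f(1) g(1)] polynomial_on_mult_nonzero[OF f(1,2) g(1,2)] f(3) g(3)
    by (intro exI[of _ "\<lambda>x. f x * g x"]) auto
qed

lemma generically_ball:
  assumes "finite S" "\<And>i. i \<in> S \<Longrightarrow> generically K (\<Phi> i)"
  shows "generically K (\<lambda>x. \<forall>i\<in>S. \<Phi> i x)"
  using assms
proof (induction S)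
  case empty
  then show ?case by (simp add: generically_True)
next
  case (insert i S)
  then show ?case
    using generically_conj[of K "\<Phi> i" "\<lambda>x. \<forall>i\<in>S. \<Phi> i x"] by simp
qed

lemma generically_proper_algebraic_subset:
  assumes "generically K \<Phi>"
  shows "\<exists>A. proper_algebraic_subset K A \<and> (\<forall>x \<in> K \<rightarrow>\<^sub>E UNIV. x \<notin> A \<longrightarrow> \<Phi> x)"
proof -
  obtain f x where f: "polynomial_on K f" "f x \<noteq> 0" "\<And>x. f x \<noteq> 0 \<Longrightarrow> \<Phi> x"
    using assms unfolding generically_def by blast
  define A where "A = {x \<in> K \<rightarrow>\<^sub>E UNIV. f x = 0}"
  have "restrict x K \<notin> A"
    using f(2) polynomial_on_restrict[OF f(1), of x] by (simp add: A_def)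
  moreover have "restrict x K \<in> K \<rightarrow>\<^sub>E UNIV"
    by simp
  ultimately have "A \<noteq> K \<rightarrow>\<^sub>E UNIV"
    by blast
  moreover have "algebraic_subset K A"
    unfolding algebraic_subset_def using f(1) by (intro exI[of _ "{f}"]) (auto simp: A_def)
  ultimately show ?thesis
    using f(3) by (intro exI[of _ A]) (auto simp: proper_algebraic_subset_def A_def)
qed


section \<open>Linear systems with polynomial coefficients\<close>

definition trivial_kernel :: "'r set \<Rightarrow> 'c set \<Rightarrow> ('r \<Rightarrow> 'c \<Rightarrow> real) \<Rightarrow> bool"
  where "trivial_kernel R C a \<longleftrightarrow>
    (\<forall>q. (\<forall>r\<in>R. (\<Sum>j\<in>C. a r j * q j) = 0) \<longrightarrow> (\<forall>j\<in>C. q j = 0))"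

lemma trivial_kernelI:
  "(\<And>q j. (\<And>r. r \<in> R \<Longrightarrow> (\<Sum>j\<in>C. a r j * q j) = 0) \<Longrightarrow> j \<in> C \<Longrightarrow> q j = 0) \<Longrightarrow>
    trivial_kernel R C a"
  unfolding trivial_kernel_def by blast

lemma trivial_kernelD:
  "trivial_kernel R C a \<Longrightarrow> (\<And>r. r \<in> R \<Longrightarrow> (\<Sum>j\<in>C. a r j * q j) = 0) \<Longrightarrow> j \<in> C \<Longrightarrow> q j = 0"
  unfolding trivial_kernel_def by blast

text \<open>One step of fraction-free Gaussian elimination; the pivot row becomes zero.\<close>

lemma trivial_kernel_eliminate:
  assumes "finite C" "j \<notin> C" "r \<in> R" and pivot: "a r j \<noteq> 0"
  shows "trivial_kernel R (insert j C) a \<longleftrightarrow>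
    trivial_kernel R C (\<lambda>r' k. a r j * a r' k - a r' j * a r k)" (is "_ \<longleftrightarrow> trivial_kernel R C ?b")
proof -
  have b: "(\<Sum>k\<in>C. ?b r' k * q k) =
      a r j * (\<Sum>k\<in>C. a r' k * q k) - a r' j * (\<Sum>k\<in>C. a r k * q k)" for r' q
    by (simp add: sum_distrib_left sum_subtractf algebra_simps)
  have a: "(\<Sum>k\<in>insert j C. a r' k * q k) = a r' j * q j + (\<Sum>k\<in>C. a r' k * q k)" for r' q
    using assms by simp
  show ?thesis
  proof
    assume L: "trivial_kernel R (insert j C) a"
    show "trivial_kernel R C ?b"
    proof (rule trivial_kernelI)
      fix q k
      assume q: "\<And>r'. r' \<in> R \<Longrightarrow> (\<Sum>k\<in>C. ?b r' k * q k) = 0" and k: "k \<in> C"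
      define c where "c = - (\<Sum>k\<in>C. a r k * q k) / a r j"
      have "(q(j := c)) k = 0"
      proof (rule trivial_kernelD[OF L])
        fix r' assume r': "r' \<in> R"
        have "(\<Sum>k\<in>C. a r' k * (q(j := c)) k) = (\<Sum>k\<in>C. a r' k * q k)"
          using assms by (intro sum.cong) auto
        moreover have "a r j * (a r' j * c + (\<Sum>k\<in>C. a r' k * q k)) = 0"
          using q[OF r'] pivot unfolding b by (simp add: c_def field_simps)
        ultimately show "(\<Sum>k\<in>insert j C. a r' k * (q(j := c)) k) = 0"
          unfolding a using pivot by simp
      qed (use k in simp)
      then show "q k = 0"
        using k assms(2) by (cases "k = j") auto
    qed
  next
    assume L: "trivial_kernel R C ?b"
    show "trivial_kernel R (insert j C) a"
    proof (rule trivial_kernelI)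
      fix q k
      assume q: "\<And>r'. r' \<in> R \<Longrightarrow> (\<Sum>k\<in>insert j C. a r' k * q k) = 0" and k: "k \<in> insert j C"
      have s: "(\<Sum>k\<in>C. a r' k * q k) = - (a r' j * q j)" if "r' \<in> R" for r'
        using q[OF that] unfolding a by simp
      have 0: "q k = 0" if "k \<in> C" for k
        by (rule trivial_kernelD[OF L _ that]) (simp add: b s assms(3))
      moreover have "q j = 0"
        using s[OF assms(3)] pivot 0 by simp
      ultimately show "q k = 0"
        using k by blast
    qed
  qed
qed

text \<open>The polynomial is the product of the pivots of an elimination at \<open>x\<close>, and
  takes the place of a maximal minor. Pivot positions are chosen at \<open>x\<close> and kept for
  all \<open>y\<close>; as nothing is divided, each pivot is a polynomial in the entries.\<close>

lemma trivial_kernel_polynomial: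
  fixes a :: "'r \<Rightarrow> 'c \<Rightarrow> ('k \<Rightarrow> real) \<Rightarrow> real"
  assumes "finite C" "\<And>r j. r \<in> R \<Longrightarrow> j \<in> C \<Longrightarrow> polynomial_on K (a r j)"
    and "trivial_kernel R C (\<lambda>r j. a r j x)"
  shows "\<exists>f. polynomial_on K f \<and> f x \<noteq> 0 \<and> (\<forall>y. f y \<noteq> 0 \<longrightarrow> trivial_kernel R C (\<lambda>r j. a r j y))"
  using assms
proof (induction C arbitrary: a)
  case empty
  then show ?case
    by (intro exI[of _ "\<lambda>x. 1"]) (auto simp: trivial_kernel_def intro: polynomial_on.const)
next
  case (insert j C)
  \<comment> \<open>If column \<open>j\<close> vanished at \<open>x\<close>, the indicator of
    \<open>j\<close> would be a kernel vector.\<close>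
  obtain r where r: "r \<in> R" "a r j x \<noteq> 0"
  proof (rule ccontr)
    assume "\<not> thesis"
    then have "\<And>r. r \<in> R \<Longrightarrow> a r j x = 0"
      using that by blast
    then have "of_bool (j = j) = (0 :: real)"
      using insert.hyps
      by (intro trivial_kernelD[OF insert.prems(2), where q = "\<lambda>k. of_bool (k = j)"]) auto
    then show False
      by simp
  qed
  define b where "b r' k y = a r j y * a r' k y - a r' j y * a r k y" for r' k y
  have b: "trivial_kernel R (insert j C) (\<lambda>r j. a r j y) \<longleftrightarrow> trivial_kernel R C (\<lambda>r j. b r j y)"
    if "a r j y \<noteq> 0" for y
    unfolding b_def using insert.hyps r(1) that
    by (intro trivial_kernel_eliminate[where a = "\<lambda>r j. a r j y"])
  have "polynomial_on K (b r' k)" if "r' \<in> R" "k \<in> C" for r' k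
    unfolding b_def[abs_def] using that r(1)
    by (intro polynomial_on_diff polynomial_on.mult insert.prems) auto
  then obtain f where f: "polynomial_on K f" "f x \<noteq> 0"
      "\<And>y. f y \<noteq> 0 \<Longrightarrow> trivial_kernel R C (\<lambda>r j. b r j y)"
    using insert.IH[of b] insert.prems(2) b[OF r(2)] by blast
  show ?case
    using f r b insert.prems(1)[OF r(1), of j]
    by (intro exI[of _ "\<lambda>y. a r j y * f y"]) (auto intro!: polynomial_on.mult)
qed

lemma nontrivial_kernel:
  assumes "finite C" "finite R" "card R < card C"
  shows "\<not> trivial_kernel R C a"
  using assms
proof (induction C arbitrary: R a)
  case empty
  then show ?case by simp
next
  case (insert j C)
  show ?case
  proof (cases "\<exists>r\<in>R. a r j \<noteq> 0")
    case True
    then obtain r where r: "r \<in> R" "a r j \<noteq> 0"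
      by blast
    let ?b = "\<lambda>r' k. a r j * a r' k - a r' j * a r k"
    have "card (R - {r}) < card C"
      using insert.hyps insert.prems card_Diff1_less[OF insert.prems(1) r(1)] by simp
    then have "\<not> trivial_kernel (R - {r}) C ?b"
      using insert by simp
    then obtain q k where "\<And>r'. r' \<in> R - {r} \<Longrightarrow> (\<Sum>k\<in>C. ?b r' k * q k) = 0"
        "k \<in> C" "q k \<noteq> 0"
      unfolding trivial_kernel_def by blast
    moreover have "(\<Sum>k\<in>C. ?b r k * q k) = 0"
      by simp
    ultimately have "\<not> trivial_kernel R C ?b"
      unfolding trivial_kernel_def by blast
    then show ?thesis
      using trivial_kernel_eliminate[of C j r R a] insert.hyps r by simp
  next
    case False
    show ?thesis
    proof
      assume "trivial_kernel R (insert j C) a"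
      then have "of_bool (j = j) = (0 :: real)"
        using False insert.hyps
        by (intro trivial_kernelD[where q = "\<lambda>k. of_bool (k = j)"]) auto
      then show False
        by simp
    qed
  qed
qed

text \<open>With \<open>- s\<close> adjoined as one more column there are fewer rows than columns,
  hence a kernel vector. Its entry in that column is nonzero because the original columns have
  trivial kernel, and dividing by it yields a solution.\<close>

lemma trivial_kernel_solvable:
  assumes "finite C" "finite R" "card R \<le> card C" and tk: "trivial_kernel R C a"
  shows "\<exists>q. \<forall>r\<in>R. (\<Sum>j\<in>C. a r j * q j) = s r"
proof -
  let ?a = "\<lambda>r j. case j of None \<Rightarrow> - s r | Some j \<Rightarrow> a r j"
  have sum: "(\<Sum>j\<in>insert None (Some ` C). ?a r j * q j) =
      (\<Sum>j\<in>C. a r j * q (Some j)) - s r * q None" for r q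
    using assms(1) by (simp add: sum.reindex)
  have "card R < card (insert None (Some ` C))"
    using assms by (simp add: card_image)
  then have "\<not> trivial_kernel R (insert None (Some ` C)) ?a"
    using assms by (intro nontrivial_kernel) auto
  then obtain q j where q: "\<And>r. r \<in> R \<Longrightarrow> (\<Sum>j\<in>C. a r j * q (Some j)) = s r * q None"
      "j \<in> insert None (Some ` C)" "q j \<noteq> 0"
    unfolding trivial_kernel_def sum by auto
  have "q None \<noteq> 0"
  proof
    assume "q None = 0"
    then have "q (Some j) = 0" if "j \<in> C" for j
      using q(1) that by (intro trivial_kernelD[OF tk, where q = "\<lambda>j. q (Some j)"]) auto
    then show False
      using q(2,3) \<open>q None = 0\<close> by auto
  qed
  then show ?thesis
    using q(1) by (intro exI[of _ "\<lambda>j. q (Some j) / q None"]) (simp flip: sum_divide_distrib)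
qed


section \<open>Splitting a tight graph into two connected subgraphs\<close>

text \<open>
  Rado's theorem: an element may be deleted from one of the sets unless the Hall condition is tight
  there, and by submodularity this cannot happen for two elements of the same set.
\<close>

lemma rado:
  fixes r :: "'a set \<Rightarrow> nat"
  assumes mono: "\<And>X Y. finite Y \<Longrightarrow> X \<subseteq> Y \<Longrightarrow> r X \<le> r Y"
    and submodular: "\<And>X Y. finite X \<Longrightarrow> finite Y \<Longrightarrow> r (X \<union> Y) + r (X \<inter> Y) \<le> r X + r Y"
    and empty: "r {} = 0"
    and "finite I" "\<And>i. i \<in> I \<Longrightarrow> finite (A i)"
    and "\<And>J. J \<subseteq> I \<Longrightarrow> card J \<le> r (\<Union> (A ` J))"
  shows "\<exists>f. (\<forall>i\<in>I. f i \<in> A i) \<and> card I \<le> r (f ` I)"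
  using assms(4-6)
proof (induction "\<Sum>i\<in>I. card (A i)" arbitrary: A rule: less_induct)
  case less
  note fin = less.prems(1,2) and hall = less.prems(3)
  show ?case
  proof (cases "\<exists>i\<in>I. \<exists>x\<in>A i. \<exists>y\<in>A i. x \<noteq> y")
    case False
    have "A i \<noteq> {}" if "i \<in> I" for i
      using hall[of "{i}"] that empty by auto
    then have "\<forall>i\<in>I. \<exists>x. x \<in> A i"
      by blast
    then obtain f where f: "\<And>i. i \<in> I \<Longrightarrow> f i \<in> A i"
      by metis
    have "A i = {f i}" if "i \<in> I" for i
      using False f[OF that] that by auto
    then have "\<Union> (A ` I) = f ` I"
      by auto
    then show ?thesis
      using f hall[of I] by auto
  next
    case True
    then obtain i x y where i: "i \<in> I" "x \<in> A i" "y \<in> A i" "x \<noteq> y"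
      by blast
    have step: ?thesis
      if z: "z \<in> A i" and h: "\<And>J. J \<subseteq> I \<Longrightarrow> card J \<le> r (\<Union> ((A(i := A i - {z})) ` J))" for z
    proof -
      let ?A = "A(i := A i - {z})"
      have "card (?A k) \<le> card (A k)" if "k \<in> I" for k
        using fin(2)[OF that] by (auto intro: card_mono)
      moreover have "card (?A i) < card (A i)"
        using fin(2) i(1) z by (simp add: card_Diff1_less del: card_Diff_insert)
      ultimately have "(\<Sum>k\<in>I. card (?A k)) < (\<Sum>k\<in>I. card (A k))"
        using fin(1) i(1) by (intro sum_strict_mono_ex1) auto
      moreover have "\<And>k. k \<in> I \<Longrightarrow> finite (?A k)"
        using fin(2) by auto
      ultimately obtain f where f: "\<forall>k\<in>I. f k \<in> ?A k" "card I \<le> r (f ` I)"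
        using less.hyps[of ?A] fin(1) h by blast
      have "\<forall>k\<in>I. f k \<in> A k"
        using f(1) by (metis DiffD1 fun_upd_apply)
      then show ?thesis
        using f(2) by blast
    qed
    have tight: "\<exists>J. J \<subseteq> I - {i} \<and> r (\<Union> (A ` J) \<union> (A i - {z})) \<le> card J"
      if nz: "\<not> (\<forall>J. J \<subseteq> I \<longrightarrow> card J \<le> r (\<Union> ((A(i := A i - {z})) ` J)))" for z
    proof -
      from nz obtain J where J: "J \<subseteq> I" "r (\<Union> ((A(i := A i - {z})) ` J)) < card J"
        by (auto simp: not_le)
      have iJ: "i \<in> J"
      proof (rule ccontr)
        assume "i \<notin> J"
        then have "(A(i := A i - {z})) ` J = A ` J"
          by (intro image_cong) auto
        then show False
          using J hall[of J] by simp
      qed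
      have "\<Union> ((A(i := A i - {z})) ` J) = \<Union> (A ` (J - {i})) \<union> (A i - {z})"
        using iJ by (auto split: if_splits)
      moreover have "card (J - {i}) = card J - 1"
        using iJ by simp
      ultimately show ?thesis
        using J by (intro exI[of _ "J - {i}"]) auto
    qed
    show ?thesis
    proof (rule ccontr)
      assume no: "\<not> ?thesis"
      obtain J1 where J1: "J1 \<subseteq> I - {i}" "r (\<Union> (A ` J1) \<union> (A i - {x})) \<le> card J1"
        using tight[of x] step[OF i(2)] no by blast
      obtain J2 where J2: "J2 \<subseteq> I - {i}" "r (\<Union> (A ` J2) \<union> (A i - {y})) \<le> card J2"
        using tight[of y] step[OF i(3)] no by blast
      let ?X = "\<Union> (A ` J1) \<union> (A i - {x})" and ?Y = "\<Union> (A ` J2) \<union> (A i - {y})"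
      have finJ: "finite J1" "finite J2"
        using J1(1) J2(1) fin(1) by (meson finite_Diff finite_subset)+
      have finX: "finite ?X" and finY: "finite ?Y"
        using J1(1) J2(1) fin(2) i(1) finJ by auto
      \<comment> \<open>As \<open>x \<noteq> y\<close>, the union of \<open>?X\<close> and
        \<open>?Y\<close> contains all of \<open>A i\<close>, so the Hall condition applies with
        \<open>i\<close> included; this extra element contradicts submodularity.\<close>
      have "card (insert i (J1 \<union> J2)) \<le> r (\<Union> (A ` insert i (J1 \<union> J2)))"
        using J1(1) J2(1) i(1) by (intro hall) auto
      also have "\<dots> \<le> r (?X \<union> ?Y)"
        using finX finY i(4) by (intro mono) auto
      finally have 1: "Suc (card (J1 \<union> J2)) \<le> r (?X \<union> ?Y)"
        using J1(1) J2(1) finJ by (subst (asm) card_insert_disjoint) auto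
      have "card (J1 \<inter> J2) \<le> r (\<Union> (A ` (J1 \<inter> J2)))"
        using J1(1) by (intro hall) auto
      also have "\<dots> \<le> r (?X \<inter> ?Y)"
        using finX by (intro mono) auto
      finally have 2: "card (J1 \<inter> J2) \<le> r (?X \<inter> ?Y)" .
      show False
        using 1 2 submodular[OF finX finY] J1(2) J2(2) card_Un_Int[OF finJ] by linarith
    qed
  qed
qed

section \<open>Dimension as a monotone and submodular rank function on finite sets\<close>

context vector_space
begin

text \<open>Functions on an infinite type form an infinite-dimensional space, so finiteness is asked
  of the sets and not of the space.\<close>

lemma dim_mono_finite:
  assumes "finite B" "A \<subseteq> B"
  shows "dim A \<le> dim B"
proof -
  obtain C where C: "C \<subseteq> B" "independent C" "B \<subseteq> span C" "card C = dim B"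
    using basis_exists by blast
  have "A \<subseteq> span C" "finite C"
    using C assms finite_subset by auto
  then show ?thesis
    using dim_le_card C(4) by metis
qed

text \<open>Extend a basis of \<open>A \<inter> B\<close> to bases \<open>D\<close> of
  \<open>A\<close> and \<open>E\<close> of \<open>B\<close>: their union spans
  \<open>A \<union> B\<close>, and their intersection contains the common basis.\<close>

lemma dim_submodular:
  assumes "finite A" "finite B"
  shows "dim (A \<union> B) + dim (A \<inter> B) \<le> dim A + dim B"
proof -
  obtain C where C: "C \<subseteq> A \<inter> B" "independent C" "A \<inter> B \<subseteq> span C" "card C = dim (A \<inter> B)"
    using basis_exists by blast
  obtain D where D: "C \<subseteq> D" "D \<subseteq> A" "independent D" "A \<subseteq> span D"
    using maximal_independent_subset_extend[of C A] C by blast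
  obtain E where E: "C \<subseteq> E" "E \<subseteq> B" "independent E" "B \<subseteq> span E"
    using maximal_independent_subset_extend[of C B] C by blast
  have fin: "finite D" "finite E"
    using D E assms finite_subset by blast+
  have "A \<union> B \<subseteq> span (D \<union> E)"
    using D(4) E(4) span_mono[of D "D \<union> E"] span_mono[of E "D \<union> E"] by blast
  then have "dim (A \<union> B) \<le> card (D \<union> E)"
    using fin by (intro dim_le_card) auto
  moreover have "dim (A \<inter> B) \<le> card (D \<inter> E)"
    using C(4) D(1) E(1) fin by (metis Int_greatest card_mono finite_Int)
  moreover have "card D = dim A" "card E = dim B"
    using D E basis_card_eq_dim by auto
  ultimately show ?thesis
    using card_Un_Int[OF fin] by linarith
qed

text \<open>A vector of \<open>B\<close> outside \<open>span A\<close> would extend a basis of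
  \<open>A\<close> to an independent subset of \<open>span B\<close> with more than
  \<open>card B\<close> elements.\<close>

lemma span_eq_if_dim_ge:
  assumes "finite B" "A \<subseteq> span B" "card B \<le> dim A"
  shows "span A = span B"
proof
  show "span A \<subseteq> span B"
    using assms(2) by (rule span_minimal) (rule subspace_span)
  obtain C where C: "C \<subseteq> A" "independent C" "A \<subseteq> span C" "card C = dim A"
    using basis_exists by blast
  have "C \<subseteq> span B"
    using C(1) assms(2) by blast
  have "finite C"
    using independent_span_bound[OF assms(1) C(2) \<open>C \<subseteq> span B\<close>] by simp
  have "B \<subseteq> span A"
  proof
    fix x assume x: "x \<in> B"
    show "x \<in> span A"
    proof (rule ccontr)
      assume "x \<notin> span A"
      then have nx: "x \<notin> span C"
        using span_mono[OF C(1)] by blast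
      then have "independent (insert x C)"
        using C(2) by (rule independent_insertI)
      moreover have "insert x C \<subseteq> span B"
        using x \<open>C \<subseteq> span B\<close> by (simp add: span_base)
      ultimately have "card (insert x C) \<le> card B"
        using independent_span_bound[OF assms(1)] by blast
      moreover have "x \<notin> C"
        using nx span_base by blast
      ultimately show False
        using \<open>finite C\<close> C(4) assms(3) by simp
    qed
  qed
  then show "span B \<subseteq> span A"
    by (rule span_minimal) (rule subspace_span)
qed

end

section \<open>Incidence vectors of graphs in the space of real functions\<close>

interpretation function_space: vector_space "\<lambda>c (f :: 'a \<Rightarrow> real) x. c * f x"
  by unfold_locales (auto simp: fun_eq_iff algebra_simps)


definition incidence :: "'w \<Rightarrow> 'w \<Rightarrow> 'w \<Rightarrow> real"
  where "incidence v w = (\<lambda>x. of_bool (x = v) - of_bool (x = w))"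

lemma incidence_self: "incidence v v = 0"
  by (simp add: incidence_def fun_eq_iff)

lemma incidence_add: "incidence u v + incidence v w = incidence u w"
  by (simp add: incidence_def fun_eq_iff)

lemma incidence_swap: "incidence w v = - incidence v w"
  by (simp add: incidence_def fun_eq_iff)

lemma sum_incidence:
  assumes "finite V" "v \<in> V" "w \<in> V"
  shows "(\<Sum>x\<in>V. incidence v w x * q x) = q v - q w"
proof -
  have "of_bool (x = a) * q x = (if x = a then q x else 0)" for x a
    by simp
  then show ?thesis
    using assms by (simp add: incidence_def left_diff_distrib sum_subtractf)
qed

text \<open>
  The equivalence classes of the relation \<open>incidence v w \<in> span X\<close> play the role of the connected
  components; \<open>\<rho>\<close> picks a representative of each.
\<close>

lemma sparse_card_le_dim:
  fixes t h :: "'i \<Rightarrow> 'w"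
  assumes "finite V" "finite J" and th: "\<And>i. i \<in> J \<Longrightarrow> t i \<in> V \<and> h i \<in> V"
    and sparse: "\<And>C. C \<subseteq> V \<Longrightarrow> C \<noteq> {} \<Longrightarrow> card {i \<in> J. t i \<in> C \<and> h i \<in> C} + 2 \<le> 2 * card C"
  shows "card J \<le> 2 * function_space.dim ((\<lambda>i. incidence (t i) (h i)) ` J)"
proof -
  define X where "X = (\<lambda>i. incidence (t i) (h i)) ` J"
  let ?W = "function_space.span X"
  define \<rho> where "\<rho> v = (SOME w. w \<in> V \<and> incidence v w \<in> ?W)" for v
  have \<rho>: "\<rho> v \<in> V" "incidence v (\<rho> v) \<in> ?W" if "v \<in> V" for v
    unfolding \<rho>_def using that someI[of "\<lambda>w. w \<in> V \<and> incidence v w \<in> ?W" v]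
    by (auto simp: incidence_self function_space.span_zero)
  have \<rho>_eq: "\<rho> v = \<rho> w" if "incidence v w \<in> ?W" for v w
  proof -
    have "incidence w v \<in> ?W"
      using that function_space.span_neg by (simp add: incidence_swap[of w v])
    then have "incidence v x \<in> ?W \<longleftrightarrow> incidence w x \<in> ?W" for x
      using that function_space.span_add[of "incidence v w" X "incidence w x"]
        function_space.span_add[of "incidence w v" X "incidence v x"]
      by (auto simp: incidence_add)
    then show ?thesis
      by (simp add: \<rho>_def)
  qed
  have \<rho>_idem: "\<rho> (\<rho> v) = \<rho> v" if "v \<in> V" for v
    using \<rho>_eq \<rho>(2) that by metis
  define Fx where "Fx = {v \<in> V. \<rho> v = v}"
  define N where "N = {v \<in> V. \<rho> v \<noteq> v}"
  have V: "V = Fx \<union> N" "Fx \<inter> N = {}"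
    by (auto simp: Fx_def N_def)
  have fin: "finite Fx" "finite N"
    using assms(1) by (auto simp: Fx_def N_def)

  \<comment> \<open>Every edge of \<open>J\<close> lies within one class. Sparsity in each class,
    summed up, gives \<open>2 * card V\<close> minus 2 for each of the \<open>card Fx\<close>
    classes, that is, \<open>2 * card N\<close>.\<close>
  have "card J \<le> card (\<Union>c\<in>Fx. {i \<in> J. \<rho> (t i) = c \<and> \<rho> (h i) = c})"
  proof (rule card_mono)
    show "finite (\<Union>c\<in>Fx. {i \<in> J. \<rho> (t i) = c \<and> \<rho> (h i) = c})"
      using fin(1) assms(2) by auto
    show "J \<subseteq> (\<Union>c\<in>Fx. {i \<in> J. \<rho> (t i) = c \<and> \<rho> (h i) = c})"
    proof
      fix i assume i: "i \<in> J"
      then have "incidence (t i) (h i) \<in> ?W"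
        by (intro function_space.span_base) (simp add: X_def)
      then have "\<rho> (t i) = \<rho> (h i)"
        by (rule \<rho>_eq)
      moreover have "\<rho> (t i) \<in> Fx"
        using \<rho>(1) \<rho>_idem th[OF i] by (simp add: Fx_def)
      ultimately show "i \<in> (\<Union>c\<in>Fx. {i \<in> J. \<rho> (t i) = c \<and> \<rho> (h i) = c})"
        using i by simp
    qed
  qed
  also have "\<dots> \<le> (\<Sum>c\<in>Fx. card {i \<in> J. \<rho> (t i) = c \<and> \<rho> (h i) = c})"
    by (rule card_UN_le[OF fin(1)])
  finally have "card J + 2 * card Fx \<le> (\<Sum>c\<in>Fx. card {i \<in> J. \<rho> (t i) = c \<and> \<rho> (h i) = c} + 2)"
    by (simp only: sum.distrib) simp
  also have "\<dots> \<le> (\<Sum>c\<in>Fx. 2 * card {v \<in> V. \<rho> v = c})"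
  proof (rule sum_mono)
    fix c assume c: "c \<in> Fx"
    have "{i \<in> J. \<rho> (t i) = c \<and> \<rho> (h i) = c} =
        {i \<in> J. t i \<in> {v \<in> V. \<rho> v = c} \<and> h i \<in> {v \<in> V. \<rho> v = c}}"
      using th by auto
    then show "card {i \<in> J. \<rho> (t i) = c \<and> \<rho> (h i) = c} + 2 \<le> 2 * card {v \<in> V. \<rho> v = c}"
      using sparse[of "{v \<in> V. \<rho> v = c}"] c by (auto simp: Fx_def)
  qed
  also have "\<dots> = 2 * card (\<Union>c\<in>Fx. {v \<in> V. \<rho> v = c})"
    using fin(1) assms(1) by (subst card_UN_disjoint) (auto simp: sum_distrib_left)
  also have "(\<Union>c\<in>Fx. {v \<in> V. \<rho> v = c}) = V"
    using \<rho>(1) \<rho>_idem by (auto simp: Fx_def)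
  finally have J: "card J \<le> 2 * card N"
    using V fin by (simp add: card_Un_disjoint)

  let ?D = "(\<lambda>v. incidence v (\<rho> v)) ` N"
  \<comment> \<open>Representatives lie outside \<open>N\<close>, so among these vectors only the
    one of \<open>v\<close> is nonzero at \<open>v\<close>; injectivity and independence
    follow.\<close>
  have eval: "incidence w (\<rho> w) v = of_bool (v = w)" if "v \<in> N" "w \<in> N" for v w
    using that \<rho>_idem[of w] by (auto simp: incidence_def N_def)
  have "inj_on (\<lambda>v. incidence v (\<rho> v)) N"
  proof (rule inj_onI)
    fix v w assume "v \<in> N" "w \<in> N" and eq: "incidence v (\<rho> v) = incidence w (\<rho> w)"
    have "of_bool (v = v) = (of_bool (v = w) :: real)"
      using eval[of v v] eval[of v w] \<open>v \<in> N\<close> \<open>w \<in> N\<close> by (simp only: eq)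
    then show "v = w"
      by (simp split: if_splits)
  qed
  then have cardD: "card ?D = card N"
    by (rule card_image)
  have "function_space.independent ?D"
    unfolding function_space.dependent_def
  proof clarify
    fix v assume v: "v \<in> N" and dep: "incidence v (\<rho> v) \<in> function_space.span (?D - {incidence v (\<rho> v)})"
    from dep have "incidence v (\<rho> v) v = 0"
    proof (induction rule: function_space.span_induct)
      case base
      show ?case
        by (auto simp: function_space.subspace_def)
    next
      case (step y)
      then show ?case
        using eval v by fastforce
    qed
    then show False
      using eval[OF v v] by simp
  qed
  moreover obtain B where B: "B \<subseteq> X" "function_space.independent B" "X \<subseteq> function_space.span B"
      "card B = function_space.dim X"
    using function_space.basis_exists by blast
  moreover have "?D \<subseteq> function_space.span B"
  proof -
    have "?W \<subseteq> function_space.span B"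
      using B(3) function_space.span_minimal function_space.subspace_span by blast
    then show ?thesis
      using \<rho>(2) by (auto simp: N_def)
  qed
  moreover have "finite B"
    using B(1) assms(2) finite_subset by (auto simp: X_def)
  ultimately have "card N \<le> function_space.dim X"
    using function_space.independent_span_bound[of B ?D] cardD by simp
  then show ?thesis
    using J by (simp add: X_def)
qed

text \<open>This is the union of two graphic matroids, obtained from Rado's theorem on two disjoint
  copies of the edges: each edge offers both copies, and the chosen copy is its colour. Colour
  classes of rank at most \<open>card V - 1\<close> reach \<open>2 * card V - 2\<close> in total
  only if both have full rank. Connectedness is expressed by functions constant along edges, because
  coordinates of points will be such functions.\<close>

lemma tight_split:
  fixes t h :: "'i \<Rightarrow> 'w"
  assumes finI: "finite I" and finV: "finite V"
    and th: "\<And>i. i \<in> I \<Longrightarrow> t i \<in> V \<and> h i \<in> V"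
    and sparse: "\<And>C. C \<subseteq> V \<Longrightarrow> C \<noteq> {} \<Longrightarrow> card {i \<in> I. t i \<in> C \<and> h i \<in> C} + 2 \<le> 2 * card C"
    and tight: "card I + 2 = 2 * card V"
  obtains f :: "'i \<Rightarrow> bool"
  where "\<And>b (q :: 'w \<Rightarrow> real) v w. (\<And>i. i \<in> I \<Longrightarrow> f i = b \<Longrightarrow> q (t i) = q (h i)) \<Longrightarrow>
    v \<in> V \<Longrightarrow> w \<in> V \<Longrightarrow> q v = q w"
proof -
  define u where "u i = incidence (t i) (h i)" for i
  define s where "s b S = u ` {i. (i, b) \<in> S}" for b :: bool and S
  define r where "r S = function_space.dim (s True S) + function_space.dim (s False S)" for S
  have fins: "finite (s b S)" if "finite S" for b S
  proof -
    have "{i. (i, b) \<in> S} \<subseteq> fst ` S"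
      by force
    then show ?thesis
      using that by (auto simp: s_def intro: finite_subset)
  qed
  have s_mono: "function_space.dim (s b X) \<le> function_space.dim (s b Y)"
    if "finite Y" "X \<subseteq> Y" for b X Y
    using fins[OF that(1)] that(2) by (intro function_space.dim_mono_finite) (auto simp: s_def)
  have s_sub: "function_space.dim (s b (X \<union> Y)) + function_space.dim (s b (X \<inter> Y))
      \<le> function_space.dim (s b X) + function_space.dim (s b Y)" if "finite X" "finite Y" for b X Y
  proof -
    have "s b (X \<union> Y) = s b X \<union> s b Y" "s b (X \<inter> Y) \<subseteq> s b X \<inter> s b Y"
      by (auto simp: s_def)
    then show ?thesis
      using function_space.dim_submodular[OF fins[OF that(1)] fins[OF that(2)], of b b]
        function_space.dim_mono_finite[of "s b X \<inter> s b Y" "s b (X \<inter> Y)"] fins[OF that(1)]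
      by fastforce
  qed
  define A where "A i = {(i, True), (i, False)}" for i :: 'i
  have hall: "card J \<le> r (\<Union> (A ` J))" if J: "J \<subseteq> I" for J
  proof -
    \<comment> \<open>Both copies contain all of \<open>J\<close>, so the Hall condition is the
      bound by twice the rank of \<open>J\<close>.\<close>
    have "s b (\<Union> (A ` J)) = u ` J" for b
      by (cases b) (auto simp: s_def A_def)
    moreover have "card J \<le> 2 * function_space.dim (u ` J)"
      unfolding u_def
    proof (rule sparse_card_le_dim[OF finV])
      show "finite J"
        using J finI finite_subset by blast
      show "t i \<in> V \<and> h i \<in> V" if "i \<in> J" for i
        using th that J by blast
      show "card {i \<in> J. t i \<in> C \<and> h i \<in> C} + 2 \<le> 2 * card C" if C: "C \<subseteq> V" "C \<noteq> {}" for C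
      proof -
        have "card {i \<in> J. t i \<in> C \<and> h i \<in> C} \<le> card {i \<in> I. t i \<in> C \<and> h i \<in> C}"
          using J finI by (intro card_mono) auto
        then show ?thesis
          using sparse[OF C] by linarith
      qed
    qed
    ultimately show ?thesis
      by (simp add: r_def)
  qed
  have "\<exists>F. (\<forall>i\<in>I. F i \<in> A i) \<and> card I \<le> r (F ` I)"
  proof (rule rado)
    show "r X \<le> r Y" if "finite Y" "X \<subseteq> Y" for X Y
      unfolding r_def using s_mono[OF that] by (simp add: add_mono)
    show "r (X \<union> Y) + r (X \<inter> Y) \<le> r X + r Y" if "finite X" "finite Y" for X Y
      unfolding r_def using s_sub[OF that, of True] s_sub[OF that, of False] by linarith
    show "r {} = 0"
      using function_space.dim_le_card'[of "{}"] by (simp add: r_def s_def)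
  qed (use finI hall in \<open>auto simp: A_def\<close>)
  then obtain F where F: "\<And>i. i \<in> I \<Longrightarrow> F i \<in> A i" "card I \<le> r (F ` I)"
    by blast
  define f where "f i = snd (F i)" for i
  have s_F: "s b (F ` I) = u ` {i \<in> I. f i = b}" for b
    using F(1) by (force simp: s_def f_def A_def image_iff)
  obtain g where g: "g \<in> V"
    using tight by fastforce
  define D where "D = (\<lambda>v. incidence v g) ` (V - {g})"
  have finD: "finite D"
    using finV by (simp add: D_def)
  have cardD: "card D + 1 \<le> card V"
    using card_image_le[of "V - {g}" "\<lambda>v. incidence v g"] finV g card_gt_0_iff[of V]
    by (fastforce simp: D_def)
  have to_g: "incidence v g \<in> function_space.span D" if "v \<in> V" for v
  proof (cases "v = g")
    case True
    then show ?thesis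
      by (simp add: incidence_self function_space.span_zero)
  next
    case False
    then show ?thesis
      using that by (intro function_space.span_base) (simp add: D_def)
  qed
  have u_span: "u ` I \<subseteq> function_space.span D"
  proof clarify
    fix i assume i: "i \<in> I"
    have "incidence (t i) g - incidence (h i) g \<in> function_space.span D"
      using th[OF i] by (intro function_space.span_diff to_g) auto
    also have "incidence (t i) g - incidence (h i) g = u i"
      by (simp add: u_def incidence_def fun_eq_iff)
    finally show "u i \<in> function_space.span D" .
  qed
  have dim_le: "function_space.dim (s b (F ` I)) \<le> card D" for b
    unfolding s_F using u_span finD by (intro function_space.dim_le_card) auto
  have dim_ge: "card D \<le> function_space.dim (s b (F ` I))" for b
    using dim_le[of True] dim_le[of False] F(2) cardD tight
    unfolding r_def by (cases b) auto
  have "q v = q w"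
    if q: "\<And>i. i \<in> I \<Longrightarrow> f i = b \<Longrightarrow> q (t i) = q (h i)"
      and v: "v \<in> V" and w: "w \<in> V"
    for b and q :: "'w \<Rightarrow> real" and v w
  proof -
    have span: "function_space.span (u ` {i \<in> I. f i = b}) = function_space.span D"
      using u_span dim_ge[of b] finD unfolding s_F
      by (intro function_space.span_eq_if_dim_ge) auto
    \<comment> \<open>Being constant along the edges of colour \<open>b\<close>, \<open>q\<close> is
      orthogonal to their span, which contains every \<open>incidence v g\<close>.\<close>
    have "(\<Sum>x\<in>V. y x * q x) = 0" if "y \<in> function_space.span (u ` {i \<in> I. f i = b})" for y
      using that
    proof (induction rule: function_space.span_induct)
      case (step y)
      then obtain i where i: "i \<in> I" "f i = b" "y = u i"
        by blast
      then show ?case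
        using q[OF i(1,2)] th[OF i(1)] finV
        by (simp add: u_def sum_incidence)
    next
      case base
      show ?case
        by (auto simp: function_space.subspace_def distrib_right sum.distrib mult.assoc
            simp flip: sum_distrib_left)
    qed
    then have "q v - q g = 0" if "v \<in> V" for v
      using to_g[OF that] that g finV unfolding span by (metis sum_incidence)
    then show ?thesis
      using v w by fastforce
  qed
  then show ?thesis
    by (rule that)
qed


section \<open>Systems of direction and slider constraints\<close>

text \<open>
  A row \<open>r\<close> stands for the constraint \<open>(P (t r) - P (h r)) \<bullet> w r = s r\<close> on positions \<open>P\<close>. The
  vertex \<^const>\<open>None\<close> is the ground, fixed at the origin, so that sliders are rows joining a
  vertex to the ground.
\<close>

definition pinned ::
  "'r set \<Rightarrow> 'v set \<Rightarrow> ('r \<Rightarrow> 'v option) \<Rightarrow> ('r \<Rightarrow> 'v option) \<Rightarrow> ('r \<Rightarrow> real ^ 2) \<Rightarrow> bool"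
  where "pinned R V t h w \<longleftrightarrow>
    (\<forall>P. P None = 0 \<longrightarrow> (\<forall>r\<in>R. (P (t r) - P (h r)) \<bullet> w r = 0) \<longrightarrow> (\<forall>v\<in>V. P (Some v) = 0))"

lemma pinnedD:
  "pinned R V t h w \<Longrightarrow> P None = 0 \<Longrightarrow> (\<And>r. r \<in> R \<Longrightarrow> (P (t r) - P (h r)) \<bullet> w r = 0) \<Longrightarrow>
    v \<in> V \<Longrightarrow> P (Some v) = 0"
  unfolding pinned_def by blast

text \<open>The unknowns are the coordinates \<open>(v, k)\<close> of proper vertices; an end
  \<open>None\<close> contributes nothing, which places the ground at the origin.\<close>

definition row_coeff :: "'v option \<Rightarrow> 'v option \<Rightarrow> real ^ 2 \<Rightarrow> 'v \<times> 2 \<Rightarrow> real"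
  where "row_coeff a b u c =
    (of_bool (a = Some (fst c)) - of_bool (b = Some (fst c))) * u $ snd c"

lemma sum_row_coeff:
  assumes "finite V" and ab: "{a, b} \<subseteq> insert None (Some ` V)" and "P None = 0"
  shows "(\<Sum>c\<in>V \<times> UNIV. row_coeff a b u c * P (Some (fst c)) $ snd c) = (P a - P b) \<bullet> u"
proof -
  have delta: "(\<Sum>v\<in>V. of_bool (a = Some v) * (P (Some v) \<bullet> u)) = P a \<bullet> u"
    if "a \<in> insert None (Some ` V)" for a
  proof (cases a)
    case None
    then show ?thesis using assms(3) by simp
  next
    case (Some x)
    have "of_bool (a = Some v) * (P (Some v) \<bullet> u) = (if v = x then P (Some v) \<bullet> u else 0)" for v
      using Some by auto
    then show ?thesis
      using Some that assms(1) by auto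
  qed
  have "(\<Sum>c\<in>V \<times> UNIV. row_coeff a b u c * P (Some (fst c)) $ snd c) =
      (\<Sum>v\<in>V. \<Sum>k\<in>UNIV. row_coeff a b u (v, k) * P (Some v) $ k)"
    by (simp add: sum.cartesian_product case_prod_unfold)
  also have "\<dots> = (\<Sum>v\<in>V. (of_bool (a = Some v) - of_bool (b = Some v)) * (P (Some v) \<bullet> u))"
    by (intro sum.cong) (simp_all add: row_coeff_def inner_vec_def sum_distrib_left mult_ac)
  also have "\<dots> = P a \<bullet> u - P b \<bullet> u"
    using ab by (simp add: left_diff_distrib sum_subtractf delta)
  finally show ?thesis
    by (simp add: inner_diff_left)
qed

lemma positions_of_coordinates:
  "\<exists>P :: 'v option \<Rightarrow> real ^ 2. P None = 0 \<and> (\<forall>c. P (Some (fst c)) $ snd c = q c)"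
  by (rule exI[of _ "case_option 0 (\<lambda>v. \<chi> k. q (v, k))"]) auto

lemma pinned_iff_trivial_kernel:
  fixes V :: "'v set"
  assumes "finite V" and th: "\<And>r. r \<in> R \<Longrightarrow> {t r, h r} \<subseteq> insert None (Some ` V)"
  shows "pinned R V t h w \<longleftrightarrow> trivial_kernel R (V \<times> UNIV) (\<lambda>r. row_coeff (t r) (h r) (w r))"
proof
  assume L: "pinned R V t h w"
  show "trivial_kernel R (V \<times> UNIV) (\<lambda>r. row_coeff (t r) (h r) (w r))"
  proof (rule trivial_kernelI)
    fix q and c :: "'v \<times> 2"
    assume q: "\<And>r. r \<in> R \<Longrightarrow> (\<Sum>c\<in>V \<times> UNIV. row_coeff (t r) (h r) (w r) c * q c) = 0"
      and c: "c \<in> V \<times> UNIV"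
    obtain P :: "'v option \<Rightarrow> real ^ 2" where P: "P None = 0" "\<And>c. P (Some (fst c)) $ snd c = q c"
      using positions_of_coordinates[of q] by blast
    have "P (Some (fst c)) = 0"
    proof (rule pinnedD[where P = P, OF L P(1)])
      show "(P (t r) - P (h r)) \<bullet> w r = 0" if "r \<in> R" for r
        using sum_row_coeff[where P = P, OF assms(1) th[OF that] P(1)] q[OF that] by (simp add: P(2))
    qed (use c in auto)
    then show "q c = 0"
      using P(2)[of c] by simp
  qed
next
  assume L: "trivial_kernel R (V \<times> UNIV) (\<lambda>r. row_coeff (t r) (h r) (w r))"
  show "pinned R V t h w"
    unfolding pinned_def
  proof (intro allI impI ballI)
    fix P v assume P: "P None = 0" "\<forall>r\<in>R. (P (t r) - P (h r)) \<bullet> w r = 0" and v: "v \<in> V"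
    have "P (Some (fst (v, k))) $ snd (v, k) = 0" for k :: 2
      using P(2) v sum_row_coeff[where P = P, OF assms(1) th P(1)]
      by (intro trivial_kernelD[OF L, where q = "\<lambda>c. P (Some (fst c)) $ snd c"]) auto
    then show "P (Some v) = 0"
      by (simp add: vec_eq_iff)
  qed
qed

lemma pinned_solvable:
  fixes V :: "'v set"
  assumes "finite R" "finite V" and th: "\<And>r. r \<in> R \<Longrightarrow> {t r, h r} \<subseteq> insert None (Some ` V)"
    and "card R \<le> 2 * card V" "pinned R V t h w"
  shows "\<exists>P. P None = 0 \<and> (\<forall>r\<in>R. (P (t r) - P (h r)) \<bullet> w r = s r)"
proof -
  have "\<exists>q. \<forall>r\<in>R. (\<Sum>c\<in>V \<times> UNIV. row_coeff (t r) (h r) (w r) c * q c) = s r"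
    using assms pinned_iff_trivial_kernel[of V R t h w]
    by (intro trivial_kernel_solvable) (auto simp: card_cartesian_product)
  then obtain q where q: "\<And>r. r \<in> R \<Longrightarrow> (\<Sum>c\<in>V \<times> UNIV. row_coeff (t r) (h r) (w r) c * q c) = s r"
    by blast
  obtain P :: "'v option \<Rightarrow> real ^ 2" where P: "P None = 0" "\<And>c. P (Some (fst c)) $ snd c = q c"
    using positions_of_coordinates[of q] by blast
  have "(P (t r) - P (h r)) \<bullet> w r = s r" if "r \<in> R" for r
    using sum_row_coeff[where P = P, OF assms(2) th[OF that] P(1)] q[OF that] by (simp add: P(2))
  then show ?thesis
    using P(1) by blast
qed

lemma not_pinned:
  fixes V :: "'v set"
  assumes "finite R" "finite V" "\<And>r. r \<in> R \<Longrightarrow> {t r, h r} \<subseteq> insert None (Some ` V)"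
    and "card R < 2 * card V"
  shows "\<not> pinned R V t h w"
proof -
  have "\<not> trivial_kernel R (V \<times> UNIV) (\<lambda>r. row_coeff (t r) (h r) (w r))"
    using assms by (intro nontrivial_kernel) (auto simp: card_cartesian_product)
  then show ?thesis
    using pinned_iff_trivial_kernel[of V R t h w] assms by blast
qed

lemma polynomial_on_row_coeff:
  assumes "\<And>k. polynomial_on K (\<lambda>x. u x $ k)"
  shows "polynomial_on K (\<lambda>x. row_coeff a b (u x) c)"
  unfolding row_coeff_def by (intro polynomial_on.mult polynomial_on.const assms)

lemma generically_pinned:
  fixes V :: "'v set"
  assumes "finite V" and th: "\<And>r. r \<in> R \<Longrightarrow> {t r, h r} \<subseteq> insert None (Some ` V)"
    and poly: "\<And>r k. r \<in> R \<Longrightarrow> polynomial_on K (\<lambda>x. w r x $ k)"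
    and "pinned R V t h (\<lambda>r. w r x)"
  shows "generically K (\<lambda>x. pinned R V t h (\<lambda>r. w r x))"
proof -
  have *: "pinned R V t h (\<lambda>r. w r x) \<longleftrightarrow>
      trivial_kernel R (V \<times> UNIV) (\<lambda>r c. row_coeff (t r) (h r) (w r x) c)" for x
    using pinned_iff_trivial_kernel[of V R t h "\<lambda>r. w r x"] assms(1) th by simp
  have "polynomial_on K (\<lambda>x. row_coeff (t r) (h r) (w r x) c)" if "r \<in> R" for r c
    using poly[OF that] by (rule polynomial_on_row_coeff)
  then show ?thesis
    using trivial_kernel_polynomial[of "V \<times> UNIV" R K "\<lambda>r c x. row_coeff (t r) (h r) (w r x) c" x]
      assms(1,4) by (auto simp: generically_def *)
qed

text \<open>
  If the system has a solution, then its matrix augmented by the right-hand side has a nontrivial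
  kernel.
\<close>

lemma generically_unsolvable:
  fixes V :: "'v set"
  assumes "finite V" and th: "\<And>r. r \<in> R \<Longrightarrow> {t r, h r} \<subseteq> insert None (Some ` V)"
    and poly: "\<And>r k. r \<in> R \<Longrightarrow> polynomial_on K (\<lambda>x. w r x $ k)"
      "\<And>r. r \<in> R \<Longrightarrow> polynomial_on K (s r)"
    and l: "l \<in> R" and pinned: "pinned (R - {l}) V t h (\<lambda>r. w r x)"
    and s: "\<And>r. r \<in> R \<Longrightarrow> s r x = of_bool (r = l)"
  shows "generically K (\<lambda>x. \<nexists>P. P None = 0 \<and> (\<forall>r\<in>R. (P (t r) - P (h r)) \<bullet> w r x = s r x))"
proof -
  define C :: "('v \<times> 2) option set" where "C = insert None (Some ` (V \<times> UNIV))"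
  define a where "a r c x =
    (case c of None \<Rightarrow> - s r x | Some c \<Rightarrow> row_coeff (t r) (h r) (w r x) c)" for r c x
  have sum: "(\<Sum>c\<in>C. a r c x * q c) =
      (\<Sum>c\<in>V \<times> UNIV. row_coeff (t r) (h r) (w r x) c * q (Some c)) - s r x * q None" for r x q
    unfolding C_def a_def using assms(1) by (simp add: sum.reindex)
  have "trivial_kernel R C (\<lambda>r c. a r c x)"
  proof (rule trivial_kernelI)
    fix q c
    assume q: "\<And>r. r \<in> R \<Longrightarrow> (\<Sum>c\<in>C. a r c x * q c) = 0" and c: "c \<in> C"
    have tk: "trivial_kernel (R - {l}) (V \<times> UNIV) (\<lambda>r. row_coeff (t r) (h r) (w r x))"
      using pinned pinned_iff_trivial_kernel[of V "R - {l}" t h "\<lambda>r. w r x"] assms(1) th by simp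
    \<comment> \<open>At \<open>x\<close> only row \<open>l\<close> has a nonzero right-hand side.
      The other rows are homogeneous and force all positions to vanish, whereupon row
      \<open>l\<close> reads \<open>q None = 0\<close>.\<close>
    have 0: "q (Some c) = 0" if "c \<in> V \<times> UNIV" for c
      by (rule trivial_kernelD[OF tk _ that]) (use q in \<open>auto simp: sum s\<close>)
    then have "q None = 0"
      using q[OF l] by (simp add: sum s[OF l])
    then show "q c = 0"
      using 0 c by (auto simp: C_def)
  qed
  moreover have "polynomial_on K (a r c)" if "r \<in> R" for r c
    using poly(2)[OF that] polynomial_on_row_coeff[OF poly(1)[OF that]]
    by (cases c) (auto simp: a_def[abs_def] polynomial_on_uminus)
  moreover have "finite C"
    using assms(1) by (simp add: C_def)
  ultimately have "generically K (\<lambda>x. trivial_kernel R C (\<lambda>r c. a r c x))"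
    using trivial_kernel_polynomial[of C R K a x] unfolding generically_def by blast
  then show ?thesis
  proof (rule generically_mono)
    fix x assume tk: "trivial_kernel R C (\<lambda>r c. a r c x)"
    show "\<nexists>P. P None = 0 \<and> (\<forall>r\<in>R. (P (t r) - P (h r)) \<bullet> w r x = s r x)"
    proof
      assume "\<exists>P. P None = 0 \<and> (\<forall>r\<in>R. (P (t r) - P (h r)) \<bullet> w r x = s r x)"
      then obtain P where P: "P None = 0" "\<And>r. r \<in> R \<Longrightarrow> (P (t r) - P (h r)) \<bullet> w r x = s r x"
        by blast
      define q where "q = case_option 1 (\<lambda>c :: 'v \<times> 2. P (Some (fst c)) $ snd c)"
      have "(\<Sum>c\<in>C. a r c x * q c) = 0" if "r \<in> R" for r
        using sum_row_coeff[where P = P, OF assms(1) th[OF that] P(1)] P(2)[OF that]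
        by (simp add: sum q_def)
      then have "q None = 0"
        by (rule trivial_kernelD[OF tk, where q = q and j = None]) (auto simp: C_def)
      then show False
        by (simp add: q_def)
    qed
  qed
qed

text \<open>
  With axis-parallel normals the two coordinates decouple, and each of them is pinned by the
  connectedness of one of the two subgraphs.
\<close>

lemma axis_parallel_pinned:
  fixes R :: "'r set" and V :: "'v set"
  assumes fin: "finite R" "finite V"
    and th: "\<And>r. r \<in> R \<Longrightarrow> {t r, h r} \<subseteq> insert None (Some ` V)"
    and sparse: "\<And>C. C \<subseteq> insert None (Some ` V) \<Longrightarrow> C \<noteq> {} \<Longrightarrow>
      card {r \<in> R. t r \<in> C \<and> h r \<in> C} + 2 \<le> 2 * card C"
    and tight: "card R = 2 * card V"
  shows "\<exists>\<kappa> :: 'r \<Rightarrow> 2. \<forall>w. (\<forall>r\<in>R. w r = axis (\<kappa> r) 1) \<longrightarrow> pinned R V t h w"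
proof -
  let ?V = "insert None (Some ` V)"
  have card: "card ?V = card V + 1"
    using fin(2) by (simp add: card_image)
  obtain f :: "'r \<Rightarrow> bool" where f: "\<And>b (q :: 'v option \<Rightarrow> real) v w.
      (\<And>r. r \<in> R \<Longrightarrow> f r = b \<Longrightarrow> q (t r) = q (h r)) \<Longrightarrow> v \<in> ?V \<Longrightarrow> w \<in> ?V \<Longrightarrow> q v = q w"
    using tight_split[of R ?V t h] fin th sparse tight card by auto
  define \<kappa> :: "'r \<Rightarrow> 2" where "\<kappa> r = (if f r then 1 else 2)" for r
  have "pinned R V t h w" if w: "\<And>r. r \<in> R \<Longrightarrow> w r = axis (\<kappa> r) 1" for w
    unfolding pinned_def
  proof (intro allI impI ballI)
    fix P v
    assume P: "P None = 0" "\<forall>r\<in>R. (P (t r) - P (h r)) \<bullet> w r = 0" and v: "v \<in> V"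
    \<comment> \<open>Colour \<open>True\<close> handles coordinate 1 and \<open>False\<close>
      coordinate 2; each colour connects all vertices to the ground.\<close>
    have "P (Some v) $ k = P None $ k" for k
    proof (rule f[where b = "k = 1" and q = "\<lambda>v. P v $ k"])
      fix r assume "r \<in> R" "f r = (k = 1)"
      moreover have "\<kappa> r = k"
        using \<open>f r = (k = 1)\<close> exhaust_2[of k] by (auto simp: \<kappa>_def)
      ultimately show "P (t r) $ k = P (h r) $ k"
        using P(2) w by (auto simp: inner_axis)
    qed (use v in auto)
    then show "P (Some v) = 0"
      using P(1) by (simp add: vec_eq_iff)
  qed
  then show ?thesis
    by blast
qed

text \<open>
  In a minimal violation of sparsity, deleting a row at the ground leaves a tight system. Its
  solution is determined, so the deleted row is violated for suitable right-hand sides. The normals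
  \<open>w\<close> may depend on auxiliary parameters \<open>\<delta>\<close>, which are fixed before genericity is considered.
\<close>

lemma generically_unsolvable_if_overcounted:
  fixes V :: "'v set" and w :: "'d \<Rightarrow> 'r \<Rightarrow> ('k \<Rightarrow> real) \<Rightarrow> real ^ 2"
  assumes fin: "finite R" "finite V"
    and th: "\<And>r. r \<in> R \<Longrightarrow> {t r, h r} \<subseteq> insert None (Some ` V)"
    and sparse: "\<And>C. C \<subseteq> Some ` V \<Longrightarrow> C \<noteq> {} \<Longrightarrow>
      card {r \<in> R. t r \<in> C \<and> h r \<in> C} + 2 \<le> 2 * card C"
    and over: "C0 \<subseteq> insert None (Some ` V)" "None \<in> C0"
      "2 * card C0 < card {r \<in> R. t r \<in> C0 \<and> h r \<in> C0} + 2"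
    and poly: "\<And>\<delta> r k. r \<in> R \<Longrightarrow> polynomial_on K (\<lambda>x. w \<delta> r x $ k)"
      "\<And>r. r \<in> R \<Longrightarrow> polynomial_on K (s r)"
    and flexible: "\<And>\<kappa> l. l \<in> R \<Longrightarrow> None \<in> {t l, h l} \<Longrightarrow>
      \<exists>\<delta> x. \<forall>r\<in>R. w \<delta> r x = axis (\<kappa> r) 1 \<and> s r x = of_bool (r = l)"
  shows "\<exists>\<delta>. generically K (\<lambda>x.
    \<nexists>P. P None = 0 \<and> (\<forall>r\<in>R. (P (t r) - P (h r)) \<bullet> w \<delta> r x = s r x))"
proof -
  \<comment> \<open>Minimising over sets of rows, and not of vertices, leaves no overcounted set
    among the rows that remain after a single deletion.\<close>
  define over where "over S C \<longleftrightarrow> S \<subseteq> {r \<in> R. t r \<in> C \<and> h r \<in> C} \<and>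
    C \<subseteq> insert None (Some ` V) \<and> None \<in> C \<and> 2 * card C < card S + 2" for S C
  have "\<exists>C. over {r \<in> R. t r \<in> C0 \<and> h r \<in> C0} C"
    using over by (auto simp: over_def)
  then have ex: "\<exists>C. over (arg_min card (\<lambda>S. \<exists>C. over S C)) C"
    by (rule arg_min_natI)
  obtain S where S: "\<exists>C. over S C" and min: "\<And>T. \<exists>C. over T C \<Longrightarrow> card S \<le> card T"
  proof (rule that[OF ex])
    show "card (arg_min card (\<lambda>S. \<exists>C. over S C)) \<le> card T" if "\<exists>C. over T C" for T
      by (rule arg_min_nat_le) (rule that)
  qed
  obtain C where C: "S \<subseteq> {r \<in> R. t r \<in> C \<and> h r \<in> C}" "C \<subseteq> insert None (Some ` V)" "None \<in> C"
      "2 * card C < card S + 2"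
    using S unfolding over_def by blast
  have finC: "finite C" and finS: "finite S"
    using finite_subset[OF C(2)] finite_subset[OF C(1)] fin by auto
  have cardC: "card C > 0"
    using C(3) finC card_gt_0_iff by blast
  \<comment> \<open>Otherwise \<open>S\<close> lies within \<open>C - {None}\<close>, where
    \<open>sparse\<close> already bounds its size.\<close>
  have "\<exists>l\<in>S. None \<in> {t l, h l}"
  proof (rule ccontr)
    assume no: "\<not> ?thesis"
    have "t r \<noteq> None \<and> h r \<noteq> None" if "r \<in> S" for r
      using no that by (metis insertCI)
    then have S': "S \<subseteq> {r \<in> R. t r \<in> C - {None} \<and> h r \<in> C - {None}}"
      using C(1) by blast
    moreover have "S \<noteq> {}"
      using C(4) cardC by auto
    ultimately have "C - {None} \<noteq> {}"
      by blast
    then have "card {r \<in> R. t r \<in> C - {None} \<and> h r \<in> C - {None}} + 2 \<le> 2 * card (C - {None})"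
      using C(2) by (intro sparse) auto
    moreover have "card S \<le> card {r \<in> R. t r \<in> C - {None} \<and> h r \<in> C - {None}}"
      using S' fin(1) by (intro card_mono) auto
    moreover have "card (C - {None}) \<le> card C"
      using finC by (intro card_mono) auto
    ultimately show False
      using C(4) by linarith
  qed
  then obtain l where l: "l \<in> S" "None \<in> {t l, h l}"
    by blast
  define W where "W = {v. Some v \<in> C}"
  have W: "C = insert None (Some ` W)"
  proof
    show "C \<subseteq> insert None (Some ` W)"
      by (auto simp: W_def) (metis (mono_tags) image_eqI mem_Collect_eq not_None_eq)
    show "insert None (Some ` W) \<subseteq> C"
      using C(3) by (auto simp: W_def)
  qed
  have finW: "finite W"
    using finC unfolding W by (metis finite_imageD finite_insert inj_Some)
  have cardW: "card C = card W + 1"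
    using finW by (simp add: W card_image)
  have less: "card (S - {l}) < card S"
    using finS l(1) by (rule card_Diff1_less)
  have thS: "{t r, h r} \<subseteq> insert None (Some ` W)" if "r \<in> S" for r
    using C(1) that W by auto
  have sparse': "card {r \<in> S - {l}. t r \<in> D \<and> h r \<in> D} + 2 \<le> 2 * card D"
    if D: "D \<subseteq> insert None (Some ` W)" "D \<noteq> {}" for D
  proof (cases "None \<in> D")
    case True
    have "card {r \<in> S - {l}. t r \<in> D \<and> h r \<in> D} \<le> card (S - {l})"
      using finS by (intro card_mono) auto
    then have "\<not> over {r \<in> S - {l}. t r \<in> D \<and> h r \<in> D} D"
      using min less by (meson le_less_trans not_le)
    moreover have "{r \<in> S - {l}. t r \<in> D \<and> h r \<in> D} \<subseteq> {r \<in> R. t r \<in> D \<and> h r \<in> D}"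
      using C(1) by blast
    moreover have "D \<subseteq> insert None (Some ` V)"
      using D(1) C(2) W by (metis order_trans)
    ultimately have "\<not> 2 * card D < card {r \<in> S - {l}. t r \<in> D \<and> h r \<in> D} + 2"
      using True unfolding over_def by blast
    then show ?thesis
      by linarith
  next
    case False
    then have "D \<subseteq> Some ` V"
      using D(1) C(2) W by blast
    then have "card {r \<in> R. t r \<in> D \<and> h r \<in> D} + 2 \<le> 2 * card D"
      using D(2) by (rule sparse)
    moreover have "card {r \<in> S - {l}. t r \<in> D \<and> h r \<in> D} \<le> card {r \<in> R. t r \<in> D \<and> h r \<in> D}"
      using fin(1) C(1) by (intro card_mono) auto
    ultimately show ?thesis
      by linarith
  qed
  have "{r \<in> S - {l}. t r \<in> C \<and> h r \<in> C} = S - {l}"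
    using C(1) by auto
  \<comment> \<open>The violation gives one inequality, sparsity of \<open>S - {l}\<close> on
    \<open>C\<close> itself the other.\<close>
  then have "card (S - {l}) = 2 * card W"
    using sparse'[of C] C(3,4) W cardW less finS l(1) by (simp add: card_Diff_singleton)
  then have "\<exists>\<kappa> :: 'r \<Rightarrow> 2. \<forall>w. (\<forall>r\<in>S - {l}. w r = axis (\<kappa> r) 1) \<longrightarrow> pinned (S - {l}) W t h w"
    using finS finW thS sparse' by (intro axis_parallel_pinned) auto
  then obtain \<kappa> :: "'r \<Rightarrow> 2"
    where \<kappa>: "\<And>w. (\<forall>r\<in>S - {l}. w r = axis (\<kappa> r) 1) \<Longrightarrow> pinned (S - {l}) W t h w"
    by blast
  obtain \<delta> x where x: "\<And>r. r \<in> R \<Longrightarrow> w \<delta> r x = axis (\<kappa> r) 1 \<and> s r x = of_bool (r = l)"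
    using flexible[of l \<kappa>] l C(1) by blast
  have "generically K (\<lambda>x. \<nexists>P. P None = 0 \<and> (\<forall>r\<in>S. (P (t r) - P (h r)) \<bullet> w \<delta> r x = s r x))"
  proof (rule generically_unsolvable[OF finW])
    show "pinned (S - {l}) W t h (\<lambda>r. w \<delta> r x)"
      using x C(1) by (intro \<kappa>) auto
  qed (use thS poly x C(1) l in auto)
  then have "generically K (\<lambda>x. \<nexists>P. P None = 0 \<and> (\<forall>r\<in>R. (P (t r) - P (h r)) \<bullet> w \<delta> r x = s r x))"
    by (rule generically_mono) (use C(1) in blast)
  then show ?thesis
    by blast
qed


section \<open>The system of a direction-slider network\<close>

text \<open>Auxiliary rows are either two sliders at one vertex or a single copy of an edge, so
  \<open>bool\<close> suffices as index type. Their common ends are the arguments of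
  \<open>row_tail\<close> and \<open>row_head\<close>.\<close>

datatype ('e, 'l) row = Edge_row 'e | Loop_row 'l | Aux_row bool

definition rows :: "'e set \<Rightarrow> 'l set \<Rightarrow> bool set \<Rightarrow> ('e, 'l) row set"
  where "rows F L B = Edge_row ` F \<union> Loop_row ` L \<union> Aux_row ` B"

lemma finite_rows: "finite F \<Longrightarrow> finite L \<Longrightarrow> finite (rows F L B)"
  using finite_subset[of B UNIV] by (simp add: rows_def)

lemma card_rows:
  assumes "finite F" "finite L"
  shows "card (rows F L B) = card F + card L + card B"
proof -
  have "card (rows F L B) = card (Edge_row ` F :: ('a, 'b) row set)
      + card (Loop_row ` L :: ('a, 'b) row set) + card (Aux_row ` B :: ('a, 'b) row set)"
    unfolding rows_def using assms finite_subset[of B UNIV]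
    by (subst card_Un_disjoint; auto)+
  then show ?thesis
    by (simp add: card_image inj_on_def)
qed

fun row_normal ::
  "(bool \<Rightarrow> real ^ 2) \<Rightarrow> ('e, 'l) row \<Rightarrow> (('e, 'l) coord \<Rightarrow> real) \<Rightarrow> real ^ 2"
  where
    "row_normal \<delta> (Edge_row e) x = vector [- x (Dir2 e), x (Dir1 e)]"
  | "row_normal \<delta> (Loop_row l) x = vector [x (Normal1 l), x (Normal2 l)]"
  | "row_normal \<delta> (Aux_row b) x = \<delta> b"

primrec row_offset :: "('e, 'l) row \<Rightarrow> (('e, 'l) coord \<Rightarrow> real) \<Rightarrow> real"
  where
    "row_offset (Edge_row e) = (\<lambda>x. 0)"
  | "row_offset (Loop_row l) = (\<lambda>x. x (Offset l))"
  | "row_offset (Aux_row b) = (\<lambda>x. 0)"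

text \<open>Each coordinate belongs to exactly one row, so normals and slider offsets can be
  prescribed independently; for an edge the rotation by \<open>perp\<close> is undone.\<close>

lemma ex_row_data:
  "\<exists>\<delta> x. \<forall>r. row_normal \<delta> r x = u r \<and> (\<forall>l. row_offset (Loop_row l) x = s l)"
proof -
  define x where "x k = (case k of
      Dir1 e \<Rightarrow> u (Edge_row e) $ 2
    | Dir2 e \<Rightarrow> - u (Edge_row e) $ 1
    | Normal1 l \<Rightarrow> u (Loop_row l) $ 1
    | Normal2 l \<Rightarrow> u (Loop_row l) $ 2
    | Offset l \<Rightarrow> s l)" for k
  have "row_normal (\<lambda>b. u (Aux_row b)) r x = u r" for r
    by (cases r) (simp_all add: x_def vec_eq_iff forall_2)
  moreover have "row_offset (Loop_row l) x = s l" for l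
    by (simp add: x_def)
  ultimately show ?thesis
    by blast
qed

lemma coords_iff [simp]:
  "Dir1 e \<in> coords G \<longleftrightarrow> e \<in> edges G"
  "Dir2 e \<in> coords G \<longleftrightarrow> e \<in> edges G"
  "Normal1 l \<in> coords G \<longleftrightarrow> l \<in> loops G"
  "Normal2 l \<in> coords G \<longleftrightarrow> l \<in> loops G"
  "Offset l \<in> coords G \<longleftrightarrow> l \<in> loops G"
  by (auto simp: coords_def)

context looped_graph
begin

definition tail :: "'e \<Rightarrow> 'v"
  where "tail e = (SOME i. \<exists>j. ends G e = {i, j})"

definition head :: "'e \<Rightarrow> 'v"
  where "head e = (SOME j. ends G e = {tail e, j})"

lemma ends_eq:
  assumes "e \<in> edges G"
  shows "ends G e = {tail e, head e}" and "tail e \<noteq> head e"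
proof -
  have "\<exists>i j. ends G e = {i, j}"
    using card_ends[OF assms] by (auto simp: card_2_iff)
  then have "\<exists>j. ends G e = {tail e, j}"
    unfolding tail_def by (rule someI_ex)
  then show eq: "ends G e = {tail e, head e}"
    unfolding head_def by (rule someI_ex)
  show "tail e \<noteq> head e"
    using card_ends[OF assms] unfolding eq by auto
qed

lemma tail_head_in_verts: "e \<in> edges G \<Longrightarrow> tail e \<in> verts G \<and> head e \<in> verts G"
  using ends_subset[of e] ends_eq[of e] by auto

lemma collapsed_iff: "e \<in> edges G \<Longrightarrow> collapsed G p e \<longleftrightarrow> p (tail e) = p (head e)"
  unfolding collapsed_def using ends_eq[of e] by (auto simp: doubleton_eq_iff)

primrec row_tail :: "'v option \<Rightarrow> ('e, 'l) row \<Rightarrow> 'v option"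
  where
    "row_tail a (Edge_row e) = Some (tail e)"
  | "row_tail a (Loop_row l) = Some (base G l)"
  | "row_tail a (Aux_row b) = a"

primrec row_head :: "'v option \<Rightarrow> ('e, 'l) row \<Rightarrow> 'v option"
  where
    "row_head a (Edge_row e) = Some (head e)"
  | "row_head a (Loop_row l) = None"
  | "row_head a (Aux_row b) = a"

definition inner_edges :: "'v set \<Rightarrow> 'e set"
  where "inner_edges C = {e \<in> edges G. ends G e \<subseteq> C}"

definition inner_loops :: "'v set \<Rightarrow> 'l set"
  where "inner_loops C = {l \<in> loops G. base G l \<in> C}"

lemma finite_inner: "finite (inner_edges C)" "finite (inner_loops C)"
  using finite_edges finite_loops by (simp_all add: inner_edges_def inner_loops_def)

lemma inner_verts: "inner_edges (verts G) = edges G" "inner_loops (verts G) = loops G"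
  using ends_subset base_in_verts by (auto simp: inner_edges_def inner_loops_def)

lemma inner_edges_empty:
  assumes "finite C" "card C < 2"
  shows "inner_edges C = {}"
proof -
  have "card (ends G e) \<le> card C" if "e \<in> inner_edges C" for e
    using that assms(1) by (intro card_mono) (auto simp: inner_edges_def)
  then show ?thesis
    using assms(2) card_ends by (fastforce simp: inner_edges_def)
qed

text \<open>A slider ends at the ground and therefore counts only for sets \<open>D\<close>
  containing \<open>None\<close>; this separates the edge count from the total count.\<close>

lemma card_inner_rows:
  assumes "F \<subseteq> edges G" "L \<subseteq> loops G"
  shows "card {r \<in> rows F L B. row_tail a r \<in> D \<and> row_head c r \<in> D} =
    card (F \<inter> inner_edges {v. Some v \<in> D}) +
    (if None \<in> D then card (L \<inter> inner_loops {v. Some v \<in> D}) else 0) +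
    (if a \<in> D \<and> c \<in> D then card B else 0)"
proof -
  have "{r \<in> rows F L B. row_tail a r \<in> D \<and> row_head c r \<in> D} =
      rows (F \<inter> inner_edges {v. Some v \<in> D})
        (if None \<in> D then L \<inter> inner_loops {v. Some v \<in> D} else {})
        (if a \<in> D \<and> c \<in> D then B else {})"
    using assms ends_eq(1)
    by (auto simp: rows_def inner_edges_def inner_loops_def)
  then show ?thesis
    by (simp add: card_rows finite_inner)
qed

lemma row_ends:
  assumes "F \<subseteq> inner_edges C" "L \<subseteq> inner_loops C" "a \<in> insert None (Some ` C)"
    "c \<in> insert None (Some ` C)" "r \<in> rows F L B"
  shows "{row_tail a r, row_head c r} \<subseteq> insert None (Some ` C)"
  using assms ends_eq(1)
  by (auto simp: rows_def inner_edges_def inner_loops_def)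

lemma polynomial_on_row:
  assumes "F \<subseteq> edges G" "L \<subseteq> loops G" "r \<in> rows F L B"
  shows "polynomial_on (coords G) (\<lambda>x. row_normal \<delta> r x $ k)"
    and "polynomial_on (coords G) (row_offset r)"
proof -
  have r: "r \<in> rows (edges G) (loops G) UNIV"
    using assms by (auto simp: rows_def)
  have "k = 1 \<or> k = 2"
    by (rule exhaust_2)
  then show "polynomial_on (coords G) (\<lambda>x. row_normal \<delta> r x $ k)"
    using r by (cases r) (auto simp: rows_def
        intro!: polynomial_on_uminus polynomial_on.coordinate polynomial_on.const)
  show "polynomial_on (coords G) (row_offset r)"
    using r by (cases r) (auto simp: rows_def
        intro!: polynomial_on.coordinate polynomial_on.const)
qed

text \<open>Extending \<open>p\<close> by the origin at the ground makes direction and slider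
  equations rows of one kind. Leaving \<open>a\<close>, \<open>c\<close> and \<open>\<delta>\<close>
  free allows the use inside systems with auxiliary rows.\<close>

lemma realization_iff_rows:
  assumes x: "x = network_point G d \<nu> s"
  shows "realization G d \<nu> s p \<longleftrightarrow> p \<in> verts G \<rightarrow>\<^sub>E UNIV \<and>
    (\<forall>r\<in>rows (edges G) (loops G) {}.
      (case_option 0 p (row_tail a r) - case_option 0 p (row_head c r)) \<bullet> row_normal \<delta> r x =
      row_offset r x)"
proof -
  have "(\<forall>i j. ends G e = {i, j} \<longrightarrow> (p i - p j) \<bullet> perp (d e) = 0) \<longleftrightarrow>
      (p (tail e) - p (head e)) \<bullet> perp (d e) = 0" if "e \<in> edges G" for e
    using ends_eq(1)[OF that] by (auto simp: doubleton_eq_iff inner_diff_left)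
  moreover have "row_normal \<delta> (Edge_row e) x = perp (d e)" if "e \<in> edges G" for e
    using that by (simp add: x network_point_def perp_def)
  moreover have "row_normal \<delta> (Loop_row l) x = \<nu> l \<and> row_offset (Loop_row l) x = s l"
    if "l \<in> loops G" for l
    using that by (simp add: x network_point_def vec_eq_iff forall_2)
  ultimately show ?thesis
    by (simp add: realization_def rows_def ball_Un)
qed


section \<open>Counting conditions\<close>

lemma subgraph_induced:
  assumes "C \<subseteq> verts G"
  shows "subgraph \<lparr>verts = C, edges = inner_edges C, loops = inner_loops C, ends = ends G, base = base G\<rparr> G"
    (is "subgraph ?H G")
proof -
  have "looped_graph ?H"
  proof
    fix i j
    have "card {e \<in> edges ?H. ends ?H e = {i, j}} \<le> card {e \<in> edges G. ends G e = {i, j}}"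
      using finite_edges by (intro card_mono) (auto simp: inner_edges_def)
    then show "card {e \<in> edges ?H. ends ?H e = {i, j}} \<le> 2"
      using at_most_two_parallel[of i j] by linarith
    have "card {l \<in> loops ?H. base ?H l = i} \<le> card {l \<in> loops G. base G l = i}"
      using finite_loops by (intro card_mono) (auto simp: inner_loops_def)
    then show "card {l \<in> loops ?H. base ?H l = i} \<le> 2"
      using at_most_two_loops[of i] by linarith
  qed (use assms finite_verts card_ends finite_inner in
      \<open>auto simp: inner_edges_def inner_loops_def intro: finite_subset\<close>)
  then show ?thesis
    using assms by (auto simp: subgraph_def inner_edges_def inner_loops_def)
qed

lemma subgraph_inner:
  assumes "subgraph H G"
  shows "edges H \<subseteq> inner_edges (verts H)" "loops H \<subseteq> inner_loops (verts H)"
proof -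
  interpret H: looped_graph H
    using assms by (simp add: subgraph_def)
  show "edges H \<subseteq> inner_edges (verts H)" "loops H \<subseteq> inner_loops (verts H)"
    using assms H.ends_subset H.base_in_verts
    by (fastforce simp: subgraph_def inner_edges_def inner_loops_def)+
qed

text \<open>On a fixed vertex set the induced subgraph has the most edges and loops, so it suffices
  to test induced subgraphs. Adding 3 on the left avoids truncated subtraction.\<close>

lemma looped_Laman_iff:
  "looped_Laman G \<longleftrightarrow>
    card (edges G) + card (loops G) = 2 * card (verts G) \<and>
    (\<forall>C \<subseteq> verts G. 2 \<le> card C \<longrightarrow> card (inner_edges C) + 3 \<le> 2 * card C) \<and>
    (\<forall>C \<subseteq> verts G. card (inner_edges C) + card (inner_loops C) \<le> 2 * card C)"
  (is "_ \<longleftrightarrow> ?tight \<and> ?edges \<and> ?total")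
proof
  assume L: "looped_Laman G"
  have "card (inner_edges C) + 3 \<le> 2 * card C" if "C \<subseteq> verts G" "2 \<le> card C" for C
  proof -
    have "card (inner_edges C) \<le> 2 * card C - 3"
      using L that subgraph_induced[of C] unfolding looped_Laman_def by fastforce
    then show ?thesis
      using that(2) by linarith
  qed
  moreover have "card (inner_edges C) + card (inner_loops C) \<le> 2 * card C" if "C \<subseteq> verts G" for C
    using L subgraph_induced[OF that] unfolding looped_Laman_def by fastforce
  ultimately show "?tight \<and> ?edges \<and> ?total"
    using L unfolding looped_Laman_def by blast
next
  assume R: "?tight \<and> ?edges \<and> ?total"
  have le: "card (edges H) \<le> card (inner_edges (verts H))"
    "card (loops H) \<le> card (inner_loops (verts H))" "verts H \<subseteq> verts G" if "subgraph H G" for H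
    using subgraph_inner[OF that] finite_inner that
    by (auto simp: subgraph_def intro!: card_mono)
  show "looped_Laman G"
    unfolding looped_Laman_def
  proof (intro conjI allI impI)
    fix H assume H: "subgraph H G \<and> 2 \<le> card (verts H)"
    then have "card (inner_edges (verts H)) + 3 \<le> 2 * card (verts H)"
      using R le(3)[of H] by blast
    then show "card (edges H) \<le> 2 * card (verts H) - 3"
      using le(1)[of H] H by linarith
  next
    fix H assume H: "subgraph H G"
    then have "card (inner_edges (verts H)) + card (inner_loops (verts H)) \<le> 2 * card (verts H)"
      using R le(3)[of H] by blast
    then show "card (edges H) + card (loops H) \<le> 2 * card (verts H)"
      using le(1,2)[of H] H by linarith
  qed (use R in blast)
qed

lemma card_option_set:
  assumes "finite D"
  shows "card D = card {v. Some v \<in> D} + of_bool (None \<in> D)"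
proof -
  have D: "D = Some ` {v. Some v \<in> D} \<union> (if None \<in> D then {None} else {})"
    by (auto simp: image_iff split: if_splits) (metis not_None_eq)+
  have "finite {v. Some v \<in> D}"
    using finite_vimageI[OF assms, of Some] by (simp add: vimage_def)
  then have "card D = card (Some ` {v. Some v \<in> D}) + card (if None \<in> D then {None :: 'a option} else {})"
    by (subst D, subst card_Un_disjoint) auto
  then show ?thesis
    by (simp add: card_image)
qed

end


section \<open>Generic realizations\<close>

context looped_graph
begin

text \<open>
  A tight set of edges with all its normals generic only has the trivial realizations, in which all
  of its vertices coincide: this is seen by pinning one vertex with two auxiliary sliders.
\<close>

lemma generically_not_faithful:
  assumes C0: "C0 \<subseteq> verts G" "2 \<le> card C0" "2 * card C0 < card (inner_edges C0) + 3"
  shows "generically (coords G) (\<lambda>x. \<forall>d \<nu> s p.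
    network_point G d \<nu> s = x \<longrightarrow> realization G d \<nu> s p \<longrightarrow> \<not> faithful G p)"
proof -
  define over where "over C \<longleftrightarrow>
    C \<subseteq> verts G \<and> 2 \<le> card C \<and> 2 * card C < card (inner_edges C) + 3" for C
  have "over C0"
    using C0 by (simp add: over_def)
  then obtain C where C: "over C" and min: "\<And>D. over D \<Longrightarrow> card C \<le> card D"
    using ex_has_least_nat[of over C0 card] by blast
  have finC: "finite C"
    using C finite_verts finite_subset by (auto simp: over_def)
  \<comment> \<open>Exactly \<open>2 * card C - 2\<close> edges are kept: together with two sliders
    at \<open>v0\<close> they form a square system.\<close>
  have "2 * card C - 2 \<le> card (inner_edges C)"
    using C by (auto simp: over_def)
  then obtain F where F: "F \<subseteq> inner_edges C" "card F = 2 * card C - 2"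
    by (metis obtain_subset_with_card_n)
  have cardF: "card F + 2 = 2 * card C"
    using F(2) C unfolding over_def by linarith
  have FE: "F \<subseteq> edges G"
    using F(1) by (auto simp: inner_edges_def)
  obtain v0 where v0: "v0 \<in> C"
    using C by (fastforce simp: over_def)
  \<comment> \<open>Proper subsets with at least two vertices obey even the Laman bound by
    minimality of \<open>C\<close>; on \<open>C\<close> itself the choice of \<open>F\<close> gives
    equality.\<close>
  have sparse: "card (F \<inter> inner_edges D) + 2 \<le> 2 * card D" if D: "D \<subseteq> C" "D \<noteq> {}" for D
  proof (cases "D = C")
    case True
    then have "F \<inter> inner_edges D = F"
      using F(1) by blast
    then show ?thesis
      using True cardF by simp
  next
    case False
    have finD: "finite D"
      using D(1) finC finite_subset by blast
    have "card D < card C"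
      using False D(1) finC by (simp add: psubset_card_mono psubset_eq)
    then have "\<not> over D"
      using min by fastforce
    show ?thesis
    proof (cases "2 \<le> card D")
      case True
      then have "card (inner_edges D) + 3 \<le> 2 * card D"
        using \<open>\<not> over D\<close> D(1) C by (auto simp: over_def)
      moreover have "card (F \<inter> inner_edges D) \<le> card (inner_edges D)"
        using finite_inner by (intro card_mono) auto
      ultimately show ?thesis
        by linarith
    next
      case False
      then have "inner_edges D = {}"
        using finD by (intro inner_edges_empty) auto
      moreover have "card D > 0"
        using D(2) finD by (simp add: card_gt_0_iff)
      ultimately show ?thesis
        by simp
    qed
  qed
  let ?R = "rows F {} UNIV :: ('e, 'l) row set" and ?t = "row_tail (Some v0)" and ?h = "row_head None"
  have finF: "finite F"
    using FE finite_edges finite_subset by blast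
  have ends: "{?t r, ?h r} \<subseteq> insert None (Some ` C)" if "r \<in> ?R" for r
    by (rule row_ends[OF F(1) _ _ _ that]) (use v0 in auto)
  have "card {r \<in> ?R. ?t r \<in> D \<and> ?h r \<in> D} + 2 \<le> 2 * card D"
    if D: "D \<subseteq> insert None (Some ` C)" "D \<noteq> {}" for D
  proof -
    let ?D = "{v. Some v \<in> D}"
    have D': "?D \<subseteq> C"
      using D(1) by auto
    have card: "card D = card ?D + of_bool (None \<in> D)"
      using D(1) finC by (intro card_option_set) (auto intro: finite_subset)
    show ?thesis
    proof (cases "?D = {}")
      case True
      then have "None \<in> D"
        using D(2) by (metis (mono_tags) Collect_empty_eq all_not_in_conv not_None_eq)
      moreover have "Some v0 \<notin> D"
        using True by blast
      ultimately show ?thesis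
        using FE True card by (simp add: card_inner_rows inner_edges_empty)
    next
      case False
      then show ?thesis
        using sparse[OF D' False] FE card by (simp add: card_inner_rows)
    qed
  qed
  moreover have "card ?R = 2 * card C"
    using finF cardF by (simp add: card_rows)
  ultimately have "\<exists>\<kappa> :: ('e, 'l) row \<Rightarrow> 2. \<forall>w. (\<forall>r\<in>?R. w r = axis (\<kappa> r) 1) \<longrightarrow> pinned ?R C ?t ?h w"
    using finC finF ends by (intro axis_parallel_pinned) (auto simp: finite_rows)
  then obtain \<kappa> :: "('e, 'l) row \<Rightarrow> 2"
    where \<kappa>: "\<And>w. (\<forall>r\<in>?R. w r = axis (\<kappa> r) 1) \<Longrightarrow> pinned ?R C ?t ?h w"
    by blast
  obtain \<delta> x where "\<And>r. row_normal \<delta> r x = axis (\<kappa> r) 1"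
    using ex_row_data[of "\<lambda>r. axis (\<kappa> r) 1"] by blast
  then have pinned: "pinned ?R C ?t ?h (\<lambda>r. row_normal \<delta> r x)"
    by (intro \<kappa> ballI)
  have "generically (coords G) (\<lambda>x. pinned ?R C ?t ?h (\<lambda>r. row_normal \<delta> r x))"
    using FE by (intro generically_pinned[where w = "row_normal \<delta>", OF finC ends _ pinned] polynomial_on_row) auto
  then show ?thesis
  proof (rule generically_mono, intro allI impI notI)
    fix x d \<nu> s p
    assume pinned: "pinned ?R C ?t ?h (\<lambda>r. row_normal \<delta> r x)"
      and x: "network_point G d \<nu> s = x" and p: "realization G d \<nu> s p" and faithful: "faithful G p"
    \<comment> \<open>Moving \<open>v0\<close> to the origin satisfies both auxiliary rows whatever
      their normals, and edge rows are invariant under translation.\<close>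
    define P where "P = case_option 0 (\<lambda>v. p v - p v0)"
    have eq: "p v = p v0" if "v \<in> C" for v
    proof -
      have "P (Some v) = 0"
      proof (rule pinnedD[where P = P, OF pinned _ _ that])
        show "(P (?t r) - P (?h r)) \<bullet> row_normal \<delta> r x = 0" if "r \<in> ?R" for r
        proof (cases r)
          case (Edge_row e)
          then have "r \<in> rows (edges G) (loops G) {}"
            using that FE by (auto simp: rows_def)
          then show ?thesis
            using p Edge_row unfolding realization_iff_rows[OF x[symmetric], of p None None \<delta>]
            by (force simp: P_def)
        qed (use that in \<open>auto simp: P_def rows_def\<close>)
      qed (simp add: P_def)
      then show ?thesis
        by (simp add: P_def)
    qed
    have "F \<noteq> {}"
      using cardF C by (auto simp: over_def)
    then obtain e where e: "e \<in> F"
      by blast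
    then have "tail e \<in> C" "head e \<in> C" "e \<in> edges G"
      using F(1) FE ends_eq(1)[of e] by (auto simp: inner_edges_def)
    then show False
      using faithful eq collapsed_iff[of e p] by (auto simp: faithful_def)
  qed
qed

text \<open>The Laman bound would be negative for a single vertex; weakened by one it holds for all
  nonempty sets, as the splitting requires.\<close>

lemma inner_edges_sparse:
  assumes "\<And>C. C \<subseteq> verts G \<Longrightarrow> 2 \<le> card C \<Longrightarrow> card (inner_edges C) + 3 \<le> 2 * card C"
    and "C \<subseteq> verts G" "C \<noteq> {}"
  shows "card (inner_edges C) + 2 \<le> 2 * card C"
proof (cases "2 \<le> card C")
  case True
  then show ?thesis
    using assms(1)[of C] assms(2) by simp
next
  case False
  have "finite C"
    using assms(2) finite_verts finite_subset by blast
  then show ?thesis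
    using False assms(3) card_gt_0_iff[of C] by (simp add: inner_edges_empty)
qed

text \<open>This is the common core of two unsolvability results: \<open>B\<close> is empty for an
  overcounted network and a singleton for a doubled edge.\<close>

lemma generically_no_positions:
  assumes ac: "B \<noteq> {} \<Longrightarrow> {a, c} \<subseteq> Some ` verts G"
    and sparse: "\<And>C. C \<subseteq> verts G \<Longrightarrow> C \<noteq> {} \<Longrightarrow>
      card (inner_edges C) + (if {a, c} \<subseteq> Some ` C then card B else 0) + 2 \<le> 2 * card C"
    and C: "C \<subseteq> verts G" "2 * card C <
      card (inner_edges C) + card (inner_loops C) + (if {a, c} \<subseteq> Some ` C then card B else 0)"
  shows "\<exists>\<delta>. generically (coords G) (\<lambda>x. \<nexists>P. P None = 0 \<and>
    (\<forall>r\<in>rows (edges G) (loops G) B.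
      (P (row_tail a r) - P (row_head c r)) \<bullet> row_normal \<delta> r x = row_offset r x))"
proof (rule generically_unsolvable_if_overcounted)
  let ?R = "rows (edges G) (loops G) B :: ('e, 'l) row set"
  let ?t = "row_tail a" and ?h = "row_head c"
  have int: "edges G \<inter> inner_edges C = inner_edges C" "loops G \<inter> inner_loops C = inner_loops C" for C
    by (auto simp: inner_edges_def inner_loops_def)
  show "finite ?R" "finite (verts G)"
    using finite_edges finite_loops finite_verts by (auto simp: finite_rows)
  show "{?t r, ?h r} \<subseteq> insert None (Some ` verts G)" if "r \<in> ?R" for r
    using that ac tail_head_in_verts base_in_verts by (cases r) (auto simp: rows_def)
  show "card {r \<in> ?R. ?t r \<in> D \<and> ?h r \<in> D} + 2 \<le> 2 * card D"
    if D: "D \<subseteq> Some ` verts G" "D \<noteq> {}" for D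
  proof -
    obtain C where "C \<subseteq> verts G" "C \<noteq> {}" "D = Some ` C"
      using D by (auto simp: subset_image_iff)
    moreover have "{v. Some v \<in> Some ` C} = C" "None \<notin> Some ` C" "card (Some ` C) = card C"
      by (auto simp: card_image)
    ultimately show ?thesis
      using sparse[of C] unfolding card_inner_rows[OF subset_refl subset_refl]
      by (simp add: int)
  qed
  let ?C0 = "insert None (Some ` C)"
  show "?C0 \<subseteq> insert None (Some ` verts G)" "None \<in> ?C0"
    using C(1) by auto
  have C0: "{v. Some v \<in> ?C0} = C"
    by auto
  have "finite C"
    using C(1) finite_verts finite_subset by blast
  then have card: "card ?C0 = card C + 1"
    by (subst card_insert_disjoint) (auto simp: card_image)
  have arith: "2 * n < m + 2" if "k \<le> k'" "m = i + k'" "2 * j < i + k" "n = j + 1" for i j k k' m n :: nat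
    using that by simp
  have "(if {a, c} \<subseteq> Some ` C then card B else 0) \<le> (if a \<in> ?C0 \<and> c \<in> ?C0 then card B else 0)"
    by auto
  moreover have "card {r \<in> ?R. ?t r \<in> ?C0 \<and> ?h r \<in> ?C0} = card (inner_edges C) + card (inner_loops C)
      + (if a \<in> ?C0 \<and> c \<in> ?C0 then card B else 0)"
    unfolding card_inner_rows[OF subset_refl subset_refl] C0 int by simp
  ultimately show "2 * card ?C0 < card {r \<in> ?R. ?t r \<in> ?C0 \<and> ?h r \<in> ?C0} + 2"
    using C(2) card by (rule arith)
  show "polynomial_on (coords G) (\<lambda>x. row_normal \<delta> r x $ k)" if "r \<in> ?R" for \<delta> r k
    by (rule polynomial_on_row(1)[OF _ _ that]) auto
  show "polynomial_on (coords G) (row_offset r)" if "r \<in> ?R" for r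
    by (rule polynomial_on_row(2)[OF _ _ that]) auto
  show "\<exists>\<delta> x. \<forall>r\<in>?R. row_normal \<delta> r x = axis (\<kappa> r) 1 \<and> row_offset r x = of_bool (r = l)"
    if l: "l \<in> ?R" "None \<in> {?t l, ?h l}" for \<kappa> :: "('e, 'l) row \<Rightarrow> 2" and l
  proof -
    \<comment> \<open>Auxiliary rows avoid the ground, so only sliders touch it; their offsets are
      coordinates of the network, hence offset 1 on \<open>l\<close> is attainable.\<close>
    obtain l' where l': "l = Loop_row l'"
      using l ac by (cases l) (auto simp: rows_def)
    obtain \<delta> x where x: "\<And>r. row_normal \<delta> r x = axis (\<kappa> r) 1"
        "\<And>j. row_offset (Loop_row j :: ('e, 'l) row) x = of_bool (j = l')"
      using ex_row_data[of "\<lambda>r. axis (\<kappa> r) 1" "\<lambda>j. of_bool (j = l')"] by blast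
    have "row_offset r x = of_bool (r = l)" for r :: "('e, 'l) row"
      using x(2) by (cases r) (simp_all add: l')
    then show ?thesis
      using x(1) by (intro exI[of _ \<delta>] exI[of _ x]) simp
  qed
qed

lemma generically_no_realization:
  assumes sparse: "\<And>C. C \<subseteq> verts G \<Longrightarrow> 2 \<le> card C \<Longrightarrow> card (inner_edges C) + 3 \<le> 2 * card C"
    and C: "C \<subseteq> verts G" "2 * card C < card (inner_edges C) + card (inner_loops C)"
  shows "generically (coords G) (\<lambda>x. \<forall>d \<nu> s p.
    network_point G d \<nu> s = x \<longrightarrow> \<not> realization G d \<nu> s p)"
proof -
  let ?R = "rows (edges G) (loops G) {} :: ('e, 'l) row set"
  let ?t = "row_tail None" and ?h = "row_head None"
  have "\<exists>\<delta>. generically (coords G) (\<lambda>x. \<nexists>P. P None = 0 \<and>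
      (\<forall>r\<in>?R. (P (?t r) - P (?h r)) \<bullet> row_normal \<delta> r x = row_offset r x))"
  proof (rule generically_no_positions[OF _ _ C(1)])
    show "card (inner_edges D) + (if {None, None} \<subseteq> Some ` D then card {} else 0) + 2 \<le> 2 * card D"
      if D: "D \<subseteq> verts G" "D \<noteq> {}" for D
    proof -
      have "card (inner_edges D) + 2 \<le> 2 * card D"
        by (rule inner_edges_sparse[OF _ D]) (rule sparse)
      then show ?thesis
        by simp
    qed
  qed (use C(2) in simp_all)
  then obtain \<delta> where "generically (coords G) (\<lambda>x. \<nexists>P. P None = 0 \<and>
      (\<forall>r\<in>?R. (P (?t r) - P (?h r)) \<bullet> row_normal \<delta> r x = row_offset r x))" ..
  then show ?thesis
  proof (rule generically_mono, intro allI impI notI)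
    fix x d \<nu> s p
    assume no: "\<nexists>P. P None = 0 \<and>
        (\<forall>r\<in>?R. (P (?t r) - P (?h r)) \<bullet> row_normal \<delta> r x = row_offset r x)"
      and x: "network_point G d \<nu> s = x" and p: "realization G d \<nu> s p"
    have "\<forall>r\<in>?R. (case_option 0 p (?t r) - case_option 0 p (?h r)) \<bullet> row_normal \<delta> r x = row_offset r x"
      using p realization_iff_rows[OF x[symmetric], of p None None \<delta>] by blast
    then have "\<exists>P. P None = 0 \<and>
        (\<forall>r\<in>?R. (P (?t r) - P (?h r)) \<bullet> row_normal \<delta> r x = row_offset r x)"
      by (intro exI[of _ "case_option 0 p"]) simp
    with no show False ..
  qed
qed

text \<open>
  If \<open>e\<close> collapses, then the realization satisfies a parallel copy of \<open>e\<close> with any direction, although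
  adding this copy makes the system overdetermined.
\<close>

lemma generically_not_collapsed:
  assumes Laman: "looped_Laman G" and e: "e \<in> edges G"
  shows "generically (coords G) (\<lambda>x. \<forall>d \<nu> s p.
    network_point G d \<nu> s = x \<longrightarrow> realization G d \<nu> s p \<longrightarrow> \<not> collapsed G p e)"
proof -
  let ?a = "Some (tail e)" and ?c = "Some (head e)"
  let ?R = "rows (edges G) (loops G) {True} :: ('e, 'l) row set"
  let ?t = "row_tail ?a" and ?h = "row_head ?c"
  have ac: "tail e \<in> verts G" "head e \<in> verts G" "tail e \<noteq> head e"
    using tail_head_in_verts[OF e] ends_eq[OF e] by auto
  have edges: "card (inner_edges C) + 3 \<le> 2 * card C" if "C \<subseteq> verts G" "2 \<le> card C" for C
    using Laman that unfolding looped_Laman_iff by blast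
  \<comment> \<open>On sets with at least two vertices the Laman bound leaves one edge to spare,
    which the copy of \<open>e\<close> uses up, while on the whole graph the copy raises the total
    to \<open>2 n + 1\<close>.\<close>
  have "\<exists>\<delta>. generically (coords G) (\<lambda>x. \<nexists>P. P None = 0 \<and>
      (\<forall>r\<in>?R. (P (?t r) - P (?h r)) \<bullet> row_normal \<delta> r x = row_offset r x))"
  proof (rule generically_no_positions[OF _ _ subset_refl])
    show "{?a, ?c} \<subseteq> Some ` verts G"
      using ac by auto
    show "card (inner_edges C) + (if {?a, ?c} \<subseteq> Some ` C then card {True} else 0) + 2 \<le> 2 * card C"
      if C: "C \<subseteq> verts G" "C \<noteq> {}" for C
    proof (cases "{?a, ?c} \<subseteq> Some ` C")
      case True
      then have "card {tail e, head e} \<le> card C"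
        using C(1) finite_verts finite_subset by (intro card_mono) auto
      then show ?thesis
        using edges[OF C(1)] ac(3) by simp
    next
      case False
      have "card (inner_edges C) + 2 \<le> 2 * card C"
        by (rule inner_edges_sparse[OF _ C]) (rule edges)
      then show ?thesis
        unfolding if_not_P[OF False] by simp
    qed
    show "2 * card (verts G) < card (inner_edges (verts G)) + card (inner_loops (verts G))
        + (if {?a, ?c} \<subseteq> Some ` verts G then card {True} else 0)"
      using Laman ac by (simp add: inner_verts looped_Laman_def)
  qed
  then obtain \<delta> where "generically (coords G) (\<lambda>x. \<nexists>P. P None = 0 \<and>
      (\<forall>r\<in>?R. (P (?t r) - P (?h r)) \<bullet> row_normal \<delta> r x = row_offset r x))" ..
  then show ?thesis
  proof (rule generically_mono, intro allI impI notI)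
    fix x d \<nu> s p
    assume no: "\<nexists>P. P None = 0 \<and>
        (\<forall>r\<in>?R. (P (?t r) - P (?h r)) \<bullet> row_normal \<delta> r x = row_offset r x)"
      and x: "network_point G d \<nu> s = x" and p: "realization G d \<nu> s p" and "collapsed G p e"
    then have "p (tail e) = p (head e)"
      using collapsed_iff[OF e] by blast
    then have "\<forall>r\<in>?R. (case_option 0 p (?t r) - case_option 0 p (?h r)) \<bullet> row_normal \<delta> r x = row_offset r x"
      using p realization_iff_rows[OF x[symmetric], of p ?a ?c \<delta>] by (auto simp: rows_def)
    then have "\<exists>P. P None = 0 \<and>
        (\<forall>r\<in>?R. (P (?t r) - P (?h r)) \<bullet> row_normal \<delta> r x = row_offset r x)"
      by (intro exI[of _ "case_option 0 p"]) simp
    with no show False ..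
  qed
qed

text \<open>Counted with the ground, the Laman conditions yield the sparsity needed for the
  splitting: \<open>n'\<close> vertices and the ground carry at most
  \<open>2 n' = 2 (n' + 1) - 2\<close> rows. The system is square, so pinning gives existence and
  uniqueness together; faithfulness is a conjunction over finitely many edges.\<close>

lemma generically_unique_faithful:
  assumes Laman: "looped_Laman G"
  shows "generically (coords G) (\<lambda>x. \<forall>d \<nu> s.
    network_point G d \<nu> s = x \<longrightarrow> (\<exists>!p. realization G d \<nu> s p \<and> faithful G p))"
proof -
  let ?R = "rows (edges G) (loops G) {} :: ('e, 'l) row set"
  let ?t = "row_tail None" and ?h = "row_head None"
  have finR: "finite ?R"
    using finite_edges finite_loops by (simp add: finite_rows)
  have ends: "{?t r, ?h r} \<subseteq> insert None (Some ` verts G)" if "r \<in> ?R" for r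
    by (rule row_ends[OF _ _ _ _ that]) (simp_all add: inner_verts)
  have "card {r \<in> ?R. ?t r \<in> D \<and> ?h r \<in> D} + 2 \<le> 2 * card D"
    if D: "D \<subseteq> insert None (Some ` verts G)" "D \<noteq> {}" for D
  proof -
    let ?D = "{v. Some v \<in> D}"
    have finD: "finite D"
      using D(1) finite_verts by (auto intro: finite_subset)
    have card: "card D = card ?D + of_bool (None \<in> D)"
      using finD by (rule card_option_set)
    have D': "?D \<subseteq> verts G"
      using D(1) by auto
    have int: "edges G \<inter> inner_edges ?D = inner_edges ?D" "loops G \<inter> inner_loops ?D = inner_loops ?D"
      by (auto simp: inner_edges_def inner_loops_def)
    show ?thesis
    proof (cases "None \<in> D")
      case True
      then show ?thesis
        using Laman D' card int unfolding looped_Laman_iff by (simp add: card_inner_rows)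
    next
      case False
      moreover have "card D \<noteq> 0"
        using finD D(2) by simp
      ultimately have "card ?D \<noteq> 0"
        using card by simp
      then have "?D \<noteq> {}"
        by (metis card.empty)
      then have "card (inner_edges ?D) + 2 \<le> 2 * card ?D"
        using Laman D' unfolding looped_Laman_iff by (intro inner_edges_sparse) auto
      then show ?thesis
        using False card int by (simp add: card_inner_rows)
    qed
  qed
  moreover have cardR: "card ?R = 2 * card (verts G)"
    using Laman finite_edges finite_loops by (simp add: card_rows looped_Laman_def)
  ultimately have "\<exists>\<kappa> :: ('e, 'l) row \<Rightarrow> 2. \<forall>w. (\<forall>r\<in>?R. w r = axis (\<kappa> r) 1) \<longrightarrow> pinned ?R (verts G) ?t ?h w"
    using finR finite_verts ends by (intro axis_parallel_pinned) auto
  then obtain \<kappa> :: "('e, 'l) row \<Rightarrow> 2"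
    where \<kappa>: "\<And>w. (\<forall>r\<in>?R. w r = axis (\<kappa> r) 1) \<Longrightarrow> pinned ?R (verts G) ?t ?h w"
    by blast
  obtain \<delta> x where "\<And>r. row_normal \<delta> r x = axis (\<kappa> r) 1"
    using ex_row_data[of "\<lambda>r. axis (\<kappa> r) 1"] by blast
  then have pinned: "pinned ?R (verts G) ?t ?h (\<lambda>r. row_normal \<delta> r x)"
    by (intro \<kappa> ballI)
  have gen: "generically (coords G) (\<lambda>x. pinned ?R (verts G) ?t ?h (\<lambda>r. row_normal \<delta> r x))"
    by (intro generically_pinned[where w = "row_normal \<delta>", OF finite_verts ends _ pinned] polynomial_on_row) auto
  have "generically (coords G) (\<lambda>x. \<forall>e\<in>edges G. \<forall>d \<nu> s p.
    network_point G d \<nu> s = x \<longrightarrow> realization G d \<nu> s p \<longrightarrow> \<not> collapsed G p e)"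
    by (intro generically_ball finite_edges generically_not_collapsed Laman)
  with gen have "generically (coords G) (\<lambda>x. pinned ?R (verts G) ?t ?h (\<lambda>r. row_normal \<delta> r x) \<and>
    (\<forall>e\<in>edges G. \<forall>d \<nu> s p.
      network_point G d \<nu> s = x \<longrightarrow> realization G d \<nu> s p \<longrightarrow> \<not> collapsed G p e))"
    by (rule generically_conj)
  then show ?thesis
  proof (rule generically_mono, intro allI impI)
    fix x d \<nu> s
    assume "pinned ?R (verts G) ?t ?h (\<lambda>r. row_normal \<delta> r x) \<and> (\<forall>e\<in>edges G. \<forall>d \<nu> s p.
        network_point G d \<nu> s = x \<longrightarrow> realization G d \<nu> s p \<longrightarrow> \<not> collapsed G p e)"
      and x: "network_point G d \<nu> s = x"
    then have pinned: "pinned ?R (verts G) ?t ?h (\<lambda>r. row_normal \<delta> r x)"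
      and faithful: "\<And>p. realization G d \<nu> s p \<Longrightarrow> faithful G p"
      by (auto simp: faithful_def)
    note rows = realization_iff_rows[OF x[symmetric], of _ None None \<delta>]
    obtain P where P: "P None = 0"
        "\<And>r. r \<in> ?R \<Longrightarrow> (P (?t r) - P (?h r)) \<bullet> row_normal \<delta> r x = row_offset r x"
      using pinned_solvable[OF finR finite_verts ends _ pinned, of "\<lambda>r. row_offset r x"] cardR
      by auto
    define p where "p = restrict (\<lambda>v. P (Some v)) (verts G)"
    have "case_option 0 p a = P a" if "a \<in> insert None (Some ` verts G)" for a
      using that P(1) by (auto simp: p_def)
    then have p: "realization G d \<nu> s p"
      using P(2) ends unfolding rows by (auto simp: p_def)
    have unique: "p' = p" if p': "realization G d \<nu> s p'" for p'
    proof
      fix v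
      show "p' v = p v"
      proof (cases "v \<in> verts G")
        case True
        \<comment> \<open>The difference of two realizations solves the homogeneous system.\<close>
        define Q where "Q a = case_option 0 p' a - case_option 0 p a" for a
        have "Q (Some v) = 0"
        proof (rule pinnedD[where P = Q, OF pinned _ _ True])
          show "(Q (?t r) - Q (?h r)) \<bullet> row_normal \<delta> r x = 0" if "r \<in> ?R" for r
          proof -
            let ?p = "case_option 0 p" and ?p' = "case_option 0 p'"
            have eq: "(?p' (?t r) - ?p' (?h r)) \<bullet> row_normal \<delta> r x = (?p (?t r) - ?p (?h r)) \<bullet> row_normal \<delta> r x"
              using p p' that unfolding rows by simp
            have Q: "Q (?t r) - Q (?h r) = (?p' (?t r) - ?p' (?h r)) - (?p (?t r) - ?p (?h r))"
              by (simp add: Q_def)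
            show ?thesis
              unfolding Q by (subst inner_diff_left) (simp only: eq diff_self)
          qed
        qed (simp add: Q_def)
        then show ?thesis
          by (simp add: Q_def)
      next
        case False
        then show ?thesis
          using p p' PiE_arb[of p "verts G" "\<lambda>_. UNIV" v] PiE_arb[of p' "verts G" "\<lambda>_. UNIV" v]
          unfolding realization_def by simp
      qed
    qed
    show "\<exists>!p. realization G d \<nu> s p \<and> faithful G p"
    proof (rule ex1I[of _ p])
      show "realization G d \<nu> s p \<and> faithful G p"
        using p faithful[OF p] ..
      show "p' = p" if "realization G d \<nu> s p' \<and> faithful G p'" for p'
        using that by (intro unique) (rule conjunct1)
    qed
  qed
qed

text \<open>A kernel vector \<open>P\<close> of the underdetermined system moves \<open>p\<close>
  along a line of realizations. No edge collapses at parameter 0, so each collapses for at most one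
  parameter, and all but finitely many points of the line are faithful.\<close>

lemma not_unique_if_undercounted:
  assumes "card (edges G) + card (loops G) < 2 * card (verts G)"
    and p: "realization G d \<nu> s p" "faithful G p"
  obtains p' where "p' \<noteq> p" "realization G d \<nu> s p'" "faithful G p'"
proof -
  let ?R = "rows (edges G) (loops G) {} :: ('e, 'l) row set"
  let ?t = "row_tail None" and ?h = "row_head None" and ?x = "network_point G d \<nu> s"
  let ?w = "\<lambda>r. row_normal (\<lambda>b. 0) r ?x"
  have ends: "{?t r, ?h r} \<subseteq> insert None (Some ` verts G)" if "r \<in> ?R" for r
    by (rule row_ends[OF _ _ _ _ that]) (simp_all add: inner_verts)
  have "\<not> pinned ?R (verts G) ?t ?h ?w"
    using assms(1) finite_edges finite_loops finite_verts ends
    by (intro not_pinned) (auto simp: finite_rows card_rows)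
  then obtain P u where P: "P None = 0" "\<And>r. r \<in> ?R \<Longrightarrow> (P (?t r) - P (?h r)) \<bullet> ?w r = 0"
      and u: "u \<in> verts G" "P (Some u) \<noteq> 0"
    unfolding pinned_def by blast
  define q where "q c = (\<lambda>v\<in>verts G. p v + c *\<^sub>R P (Some v))" for c
  have q_option: "case_option 0 (q c) a = case_option 0 p a + c *\<^sub>R P a"
    if "a \<in> insert None (Some ` verts G)" for a c
    using that P(1) by (auto simp: q_def)
  note rows = realization_iff_rows[OF refl, of d \<nu> s _ None None "\<lambda>b. 0"]
  have real: "realization G d \<nu> s (q c)" for c
  proof -
    have "(case_option 0 (q c) (?t r) - case_option 0 (q c) (?h r)) \<bullet> ?w r =
        (case_option 0 p (?t r) - case_option 0 p (?h r)) \<bullet> ?w r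
        + c * ((P (?t r) - P (?h r)) \<bullet> ?w r)" if "r \<in> ?R" for r
      using ends[OF that] by (simp add: q_option inner_diff_left inner_add_left algebra_simps)
    then show ?thesis
      using p(1) P(2) unfolding rows by (auto simp: q_def)
  qed
  have "finite {c. collapsed G (q c) e}" if e: "e \<in> edges G" for e
  proof -
    let ?a = "p (tail e) - p (head e)" and ?b = "P (Some (tail e)) - P (Some (head e))"
    have iff: "collapsed G (q c) e \<longleftrightarrow> ?a + c *\<^sub>R ?b = 0" for c
      using tail_head_in_verts[OF e] by (simp add: collapsed_iff[OF e] q_def algebra_simps)
    have "?a \<noteq> 0"
      using p(2) e collapsed_iff[OF e] by (auto simp: faithful_def)
    have "c = c'" if "collapsed G (q c) e" "collapsed G (q c') e" for c c'
    proof -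
      have "(c - c') *\<^sub>R ?b = (?a + c *\<^sub>R ?b) - (?a + c' *\<^sub>R ?b)"
        by (simp add: algebra_simps)
      then have "(c - c') *\<^sub>R ?b = 0"
        unfolding that[unfolded iff] by simp
      moreover have "?b \<noteq> 0"
        using \<open>?a \<noteq> 0\<close> that(1) iff by auto
      ultimately show ?thesis
        by simp
    qed
    then have "{c. collapsed G (q c) e} \<subseteq> {SOME c. collapsed G (q c) e}"
      by (auto intro: someI2)
    then show ?thesis
      by (rule finite_subset) simp
  qed
  then have "finite (insert 0 (\<Union>e\<in>edges G. {c. collapsed G (q c) e}))"
    using finite_edges by simp
  then obtain c where c: "c \<notin> insert 0 (\<Union>e\<in>edges G. {c. collapsed G (q c) e})"
    using ex_new_if_finite[OF infinite_UNIV_char_0] by blast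
  have "q c u \<noteq> p u"
    using u c by (simp add: q_def)
  then show ?thesis
    using that[of "q c"] real c by (auto simp: faithful_def)
qed

end

theorem theorem4:
  fixes G :: "('v, 'e, 'l) looped_graph"
  assumes "looped_graph G"
  shows "\<exists>A. proper_algebraic_subset (coords G) A \<and>
    (\<forall>(d :: 'e \<Rightarrow> real ^ 2) (\<nu> :: 'l \<Rightarrow> real ^ 2) (s :: 'l \<Rightarrow> real).
      network_point G d \<nu> s \<notin> A \<longrightarrow>
        ((\<exists>!p. realization G d \<nu> s p \<and> faithful G p) \<longleftrightarrow> looped_Laman G))"
proof -
  interpret looped_graph G by fact
  have "generically (coords G) (\<lambda>x. \<forall>d \<nu> s. network_point G d \<nu> s = x \<longrightarrow>
    ((\<exists>!p. realization G d \<nu> s p \<and> faithful G p) \<longleftrightarrow> looped_Laman G))"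
  \<comment> \<open>The right-hand side of the equivalence does not depend on the parameters, so in
    each case only one truth value of the left-hand side has to be shown generic.\<close>
  proof (cases "looped_Laman G")
    case True
    then show ?thesis
      using generically_unique_faithful by simp
  next
    case False
    have "generically (coords G) (\<lambda>x. \<forall>d \<nu> s. network_point G d \<nu> s = x \<longrightarrow>
      \<not> (\<exists>!p. realization G d \<nu> s p \<and> faithful G p))"
    \<comment> \<open>The edge bound is examined before the total bound because the argument for a
      violated total count relies on it.\<close>
    proof (cases "\<forall>C \<subseteq> verts G. 2 \<le> card C \<longrightarrow> card (inner_edges C) + 3 \<le> 2 * card C")
      case sparse: True
      show ?thesis
      proof (cases "\<forall>C \<subseteq> verts G. card (inner_edges C) + card (inner_loops C) \<le> 2 * card C")
        case True
        \<comment> \<open>With both bounds satisfied only the equality can fail, so there are too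
          few constraints.\<close>
        then have "card (edges G) + card (loops G) \<le> 2 * card (verts G)"
          using inner_verts by force
        moreover have "card (edges G) + card (loops G) \<noteq> 2 * card (verts G)"
          using False sparse True looped_Laman_iff by blast
        ultimately have "card (edges G) + card (loops G) < 2 * card (verts G)"
          by simp
        then have "\<not> (\<exists>!p. realization G d \<nu> s p \<and> faithful G p)" for d \<nu> s
          using not_unique_if_undercounted by metis
        then show ?thesis
          using generically_True generically_mono by fastforce
      next
        case False
        then obtain C where "C \<subseteq> verts G" "2 * card C < card (inner_edges C) + card (inner_loops C)"
          by (auto simp: not_le)
        then have "generically (coords G) (\<lambda>x. \<forall>d \<nu> s p.
            network_point G d \<nu> s = x \<longrightarrow> \<not> realization G d \<nu> s p)"
          using sparse by (intro generically_no_realization) auto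
        then show ?thesis
          by (rule generically_mono) blast
      qed
    next
      case False
      then obtain C where "C \<subseteq> verts G" "2 \<le> card C" "2 * card C < card (inner_edges C) + 3"
        by (auto simp: not_le)
      then have "generically (coords G) (\<lambda>x. \<forall>d \<nu> s p.
          network_point G d \<nu> s = x \<longrightarrow> realization G d \<nu> s p \<longrightarrow> \<not> faithful G p)"
        by (rule generically_not_faithful)
      then show ?thesis
        by (rule generically_mono) blast
    qed
    then show ?thesis
      by (rule generically_mono) (use False in blast)
  qed
  from generically_proper_algebraic_subset[OF this]
  obtain A where A: "proper_algebraic_subset (coords G) A"
      "\<forall>x \<in> coords G \<rightarrow>\<^sub>E UNIV. x \<notin> A \<longrightarrow> (\<forall>d \<nu> s. network_point G d \<nu> s = x \<longrightarrow>
        ((\<exists>!p. realization G d \<nu> s p \<and> faithful G p) \<longleftrightarrow> looped_Laman G))"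
    by (elim exE conjE)
  have point: "network_point G d \<nu> s \<in> coords G \<rightarrow>\<^sub>E UNIV" for d \<nu> s
    by (simp add: network_point_def)
  show ?thesis
  proof (intro exI[of _ A] conjI allI impI)
    show "(\<exists>!p. realization G d \<nu> s p \<and> faithful G p) \<longleftrightarrow> looped_Laman G"
      if "network_point G d \<nu> s \<notin> A" for d \<nu> s
      using A(2)[rule_format, OF point that refl] .
  qed (rule A(1))
qed

end
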